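(* Let $d,r\ge 1$ be fixed. Then the codimension of $\mathrm{Quot}_d(\mathcal{O}_{\mathbb{A}^n}^{\oplus r})\setminus Z_n^{l_{\max}(r)}$ in $\mathrm{Quot}_d(\mathcal{O}_{\mathbb{A}^n}^{\oplus r})$ diverges to infinity as $n\to\infty$, i.e. $$\lim_{n\to\infty}\Big(\dim \mathrm{Quot}_d(\mathcal{O}_{\mathbb{A}^n}^{\oplus r})-\dim\big(\mathrm{Quot}_d(\mathcal{O}_{\mathbb{A}^n}^{\oplus r})\setminus Z_n^{l_{\max}(r)}\big)\Big)=\infty.$$
   Context: $\Bbbk$ is an algebraically closed field of characteristic zero. $\mathrm{Quot}_d(\mathcal{O}_{\mathbb{A}^n}^{\oplus r})$ is the Quot scheme whose $\Bbbk$-points are equivalence classes of surjections of $\Bbbk[x_1,\dots,x_n]$-modules $\Bbbk[x_1,\dots,x_n]^{\oplus r}\twoheadrightarrow M$ with $\dim_{\Bbbk}M=d$. For $0\le l\le d^2$, $Z_n^l$ is the locally closed subset of points for which the linear span in $\mathrm{End}_{\Bbbk}(M)$ of the $n$ endomorphisms given by multiplication by $x_1,\dots,x_n$ has dimension exactly $l$. For $n\ge d^2$, $l_{\max}(r)$ denotes the largest integer $l\in\{0,\dots,d^2\}$ with $Z_n^l\neq\emptyset$ (for fixed $d$ it depends only on $r$). Codimension is understood as the difference of dimensions. *)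

theory Defs
  imports
    "HOL-Analysis.Analysis"
    "HOL-Library.Poly_Mapping"
    "HOL-Library.Function_Algebras"
    "HOL-Computational_Algebra.Polynomial"
begin

section \<open>Krull dimension\<close>

definition irreducible_in :: "'a topology \<Rightarrow> 'a set \<Rightarrow> bool" where
  "irreducible_in T S \<longleftrightarrow> S \<subseteq> topspace T \<and> S \<noteq> {} \<and>
     (\<forall>A B. closedin T A \<and> closedin T B \<and> S \<subseteq> A \<union> B \<longrightarrow> S \<subseteq> A \<or> S \<subseteq> B)"

text \<open>Supremum of the lengths of strict chains of irreducible closed subsets;
  the empty space gets dimension minus infinity.\<close>

definition krull_dim :: "'a topology \<Rightarrow> ereal" where
  "krull_dim T = Sup {ereal (real m) | m.
     \<exists>C :: nat \<Rightarrow> 'a set. (\<forall>i\<le>m. closedin T (C i) \<and> irreducible_in T (C i)) \<and>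
                        (\<forall>i<m. C i \<subset> C (Suc i))}"

section \<open>Polynomials and free modules\<close>

text \<open>Polynomials in countably many variables; a monomial is its exponent vector, and
  \<open>polys n\<close> is the polynomial ring in the variables with index below \<open>n\<close>.\<close>

type_synonym 'k mpoly = "(nat \<Rightarrow>\<^sub>0 nat) \<Rightarrow>\<^sub>0 'k"

definition polys :: "nat \<Rightarrow> 'k::zero mpoly set" where
  "polys n = {p. \<forall>m \<in> Poly_Mapping.keys p. Poly_Mapping.keys m \<subseteq> {..<n}}"

definition const :: "'k::zero \<Rightarrow> 'k mpoly" where
  "const c = Poly_Mapping.single 0 c"

definition var :: "nat \<Rightarrow> 'k::zero_neq_one mpoly" where
  "var j = Poly_Mapping.single (Poly_Mapping.single j 1) 1"

definition free_mod :: "nat \<Rightarrow> nat \<Rightarrow> (nat \<Rightarrow> 'k::zero mpoly) set" where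
  "free_mod n r = {f. (\<forall>i<r. f i \<in> polys n) \<and> (\<forall>i\<ge>r. f i = 0)}"

definition mscale :: "'k::comm_ring_1 mpoly \<Rightarrow> (nat \<Rightarrow> 'k mpoly) \<Rightarrow> (nat \<Rightarrow> 'k mpoly)" where
  "mscale p f = (\<lambda>i. p * f i)"

definition is_submod :: "nat \<Rightarrow> nat \<Rightarrow> (nat \<Rightarrow> 'k::comm_ring_1 mpoly) set \<Rightarrow> bool" where
  "is_submod n r K \<longleftrightarrow> K \<subseteq> free_mod n r \<and> 0 \<in> K \<and> (\<forall>f\<in>K. \<forall>g\<in>K. f + g \<in> K) \<and>
     (\<forall>p\<in>polys n. \<forall>f\<in>K. mscale p f \<in> K)"

section \<open>Points of the Quot scheme\<close>

text \<open>A surjection from the free module is determined up to equivalence by its kernel \<open>K\<close>, and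
  every submodule is the kernel of the projection to its quotient. So the points are
  the submodules \<open>K\<close> of the free module whose quotient \<open>M\<close> has dimension \<open>d\<close>.
  \<open>quot_basis n r d b K\<close> says that the classes of \<open>b 0, \<dots>, b (d - 1)\<close> form a
  basis of \<open>M\<close>.\<close>

definition quot_basis ::
  "nat \<Rightarrow> nat \<Rightarrow> nat \<Rightarrow> (nat \<Rightarrow> nat \<Rightarrow> 'k::comm_ring_1 mpoly) \<Rightarrow> (nat \<Rightarrow> 'k mpoly) set \<Rightarrow> bool" where
  "quot_basis n r d b K \<longleftrightarrow> (\<forall>i<d. b i \<in> free_mod n r) \<and>
     (\<forall>f\<in>free_mod n r. \<exists>!c :: nat \<Rightarrow> 'k. (\<forall>i\<ge>d. c i = 0) \<and>
        f - (\<Sum>i<d. mscale (const (c i)) (b i)) \<in> K)"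

definition quot_coords ::
  "nat \<Rightarrow> (nat \<Rightarrow> nat \<Rightarrow> 'k::comm_ring_1 mpoly) \<Rightarrow> (nat \<Rightarrow> 'k mpoly) set \<Rightarrow> (nat \<Rightarrow> 'k mpoly) \<Rightarrow> nat \<Rightarrow> 'k" where
  "quot_coords d b K f = (THE c. (\<forall>i\<ge>d. c i = 0) \<and>
     f - (\<Sum>i<d. mscale (const (c i)) (b i)) \<in> K)"

definition quot_points :: "nat \<Rightarrow> nat \<Rightarrow> nat \<Rightarrow> (nat \<Rightarrow> 'k::comm_ring_1 mpoly) set set" where
  "quot_points n r d = {K. is_submod n r K \<and> (\<exists>b. quot_basis n r d b K)}"

section \<open>The Zariski topology on the Quot scheme\<close>

text \<open>The Quot scheme is covered by the affine open charts indexed by \<open>d\<close>-tuples \<open>b\<close> of elements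
  of the free module, where the chart of \<open>b\<close> is the locus of quotients having \<open>b\<close> as a basis.
  The coordinate ring of a chart is generated over the ground field by the coordinates, with
  respect to \<open>b\<close>, of the classes of the elements of the free module (already by those of the
  standard generators and of the products of a variable with some \<open>b i\<close>). The Zariski topology
  has the principal open subsets of these charts as a basis.\<close>

definition chart :: "nat \<Rightarrow> nat \<Rightarrow> nat \<Rightarrow> (nat \<Rightarrow> nat \<Rightarrow> 'k::comm_ring_1 mpoly) \<Rightarrow> (nat \<Rightarrow> 'k mpoly) set set" where
  "chart n r d b = {K \<in> quot_points n r d. quot_basis n r d b K}"

inductive_set chart_ring ::
  "nat \<Rightarrow> nat \<Rightarrow> nat \<Rightarrow> (nat \<Rightarrow> nat \<Rightarrow> 'k::comm_ring_1 mpoly) \<Rightarrow> ((nat \<Rightarrow> 'k mpoly) set \<Rightarrow> 'k) set"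
  for n r d :: nat and b :: "nat \<Rightarrow> nat \<Rightarrow> 'k mpoly" where
  const: "(\<lambda>K. a) \<in> chart_ring n r d b"
| coord: "f \<in> free_mod n r \<Longrightarrow> i < d \<Longrightarrow> (\<lambda>K. quot_coords d b K f i) \<in> chart_ring n r d b"
| add: "g \<in> chart_ring n r d b \<Longrightarrow> h \<in> chart_ring n r d b \<Longrightarrow> (\<lambda>K. g K + h K) \<in> chart_ring n r d b"
| mult: "g \<in> chart_ring n r d b \<Longrightarrow> h \<in> chart_ring n r d b \<Longrightarrow> (\<lambda>K. g K * h K) \<in> chart_ring n r d b"

definition Quot :: "nat \<Rightarrow> nat \<Rightarrow> nat \<Rightarrow> (nat \<Rightarrow> 'k::comm_ring_1 mpoly) set topology" where
  "Quot n r d = topology_generated_by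
     {{K \<in> chart n r d b. g K \<noteq> 0} | b g. g \<in> chart_ring n r d b}"

lemma topspace_Quot:
  "topspace (Quot n r d :: (nat \<Rightarrow> 'a::comm_ring_1 mpoly) set topology) = quot_points n r d"
    (is "?L = ?R")
proof
  show "?L \<subseteq> ?R"
    by (auto simp: Quot_def chart_def)
  show "?R \<subseteq> ?L"
  proof
    fix K :: "(nat \<Rightarrow> 'a mpoly) set"
    assume K: "K \<in> quot_points n r d"
    then obtain b where "quot_basis n r d b K"
      by (auto simp: quot_points_def)
    with K have "K \<in> {K \<in> chart n r d b. (\<lambda>_. 1 :: 'a) K \<noteq> 0}"
      by (simp add: chart_def)
    then show "K \<in> ?L"
      unfolding Quot_def topology_generated_by_topspace
      using chart_ring.const[of "1 :: 'a" n r d b] by blast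
  qed
qed

section \<open>The strata\<close>

text \<open>Matrix, with respect to the basis of \<open>M\<close> given by \<open>b\<close>, of the endomorphism of \<open>M\<close>
  given by multiplication by the variable with index \<open>j\<close>.\<close>

definition mult_matrix ::
  "nat \<Rightarrow> (nat \<Rightarrow> nat \<Rightarrow> 'k::comm_ring_1 mpoly) \<Rightarrow> (nat \<Rightarrow> 'k mpoly) set \<Rightarrow> nat \<Rightarrow> nat \<times> nat \<Rightarrow> 'k" where
  "mult_matrix d b K j = (\<lambda>(i, k).
     if i < d \<and> k < d then quot_coords d b K (mscale (var j) (b k)) i else 0)"

definition mat_scale :: "'k::field \<Rightarrow> (nat \<times> nat \<Rightarrow> 'k) \<Rightarrow> nat \<times> nat \<Rightarrow> 'k" where
  "mat_scale c A = (\<lambda>x. c * A x)"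

lemma vector_space_mat_scale: "vector_space mat_scale"
  by unfold_locales (auto simp: mat_scale_def fun_eq_iff algebra_simps)

text \<open>The dimension below does not depend on \<open>b\<close>: a change of basis of \<open>M\<close>
  conjugates all multiplication matrices simultaneously.\<close>

definition stratum :: "nat \<Rightarrow> nat \<Rightarrow> nat \<Rightarrow> nat \<Rightarrow> (nat \<Rightarrow> 'k::field mpoly) set set" where
  "stratum n r d l = {K \<in> quot_points n r d. \<exists>b. quot_basis n r d b K \<and>
     vector_space.dim mat_scale (module.span mat_scale (mult_matrix d b K ` {..<n})) = l}"

text \<open>For \<open>n \<ge> d\<^sup>2\<close> the value does not depend on \<open>n\<close>; for smaller \<open>n\<close> it is not used.\<close>

definition l_max :: "'k::field itself \<Rightarrow> nat \<Rightarrow> nat \<Rightarrow> nat \<Rightarrow> nat" where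
  "l_max _ n r d = Max {l. l \<le> d ^ 2 \<and> (stratum n r d l :: (nat \<Rightarrow> 'k mpoly) set set) \<noteq> {}}"

text \<open>The codimension of a subset, as the difference of dimensions. The conversion to real numbers
  sends infinite values to \<open>0\<close>, so that infinite dimensions cannot make the difference infinite.\<close>

definition codim :: "'a topology \<Rightarrow> 'a set \<Rightarrow> real" where
  "codim T S = real_of_ereal (krull_dim T) - real_of_ereal (krull_dim (subtopology T S))"

end

theory Submission
  imports Defs "Jordan_Normal_Form.Determinant"
begin

text \<open>Write \<open>l\<close> for \<open>l_max\<close>; it lies between \<open>1\<close> and \<open>d\<^sup>2\<close>. Where the multiplication matrices span a
  space of dimension at most \<open>l'\<close>, they are linear combinations of \<open>l'\<close> matrices, so all regular
  functions on a chart are polynomials in \<open>n l' + l' d\<^sup>2 + r d\<close> parameters (which are only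
  functions of the point, not regular ones). A strict chain of irreducible closed sets of length \<open>m\<close>
  gives \<open>m\<close> algebraically independent regular functions, and comparing the numbers of monomials
  bounds \<open>m\<close> by the number of parameters. With \<open>l' = l - 1\<close> this bounds the dimension of the
  complement of the stratum.

  Conversely, take a point of the stratum and \<open>l\<close> variables that act by a basis of the span of the
  multiplication matrices. Substituting arbitrary linear combinations of these for the other
  \<open>n - l\<close> variables defines a map from an affine space of dimension \<open>(n - l) l\<close> to the Quot scheme,
  and the closures of the images of the coordinate subspaces form a strict chain. The difference of
  the two bounds is \<open>n\<close> up to a constant that depends only on \<open>d\<close> and \<open>r\<close>.\<close>

text \<open>A quotient amounts to \<open>n\<close> commuting matrices together with \<open>r\<close>
  vectors that generate, and commutation makes the dimension of the Quot scheme hard to compute.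
  Only its growth with \<open>n\<close> matters here, and both bounds avoid the commutation
  equations: the upper one ignores them, and the lower one uses that linear combinations of
  commuting matrices commute. The obstacle in the upper bound is that a basis of the span of the
  matrices cannot be chosen regularly in the point, so there is no parametrizing morphism to compare
  dimensions with. Counting monomials compares only spaces of functions on a set, hence the
  parameters may be chosen point by point. Since \<open>codim\<close> reads an infinite dimension as
  0, a finite upper bound for the whole Quot scheme is also required; the rank bound
  \<open>d ^ 2\<close> supplies it. Positivity of \<open>l\<close> matters because the gain of
  \<open>n\<close> comes from lowering the rank by one. Characteristic zero enters through the
  infinitude of the field, which makes the linear family irreducible, and through the distinctness
  of the points in the example of positive rank.\<close>

section \<open>Polynomial rings and induction on polynomials\<close>

lemma keys_plus_nat: "Poly_Mapping.keys (m + m') = Poly_Mapping.keys m \<union> Poly_Mapping.keys (m' :: 'a \<Rightarrow>\<^sub>0 nat)"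
  by (auto simp: in_keys_iff lookup_add)

lemma polys_0 [simp]: "0 \<in> polys n"
  by (simp add: polys_def)

lemma const_in_polys [simp]: "const c \<in> polys n"
  by (simp add: polys_def const_def)

lemma polys_1 [simp]: "(1 :: 'k::zero_neq_one mpoly) \<in> polys n"
  by (simp add: polys_def)

lemma var_in_polys [simp]: "j < n \<Longrightarrow> (var j :: 'k::zero_neq_one mpoly) \<in> polys n"
  by (simp add: polys_def var_def)

lemma polys_add: "p \<in> polys n \<Longrightarrow> q \<in> polys n \<Longrightarrow> (p + q :: 'k::monoid_add mpoly) \<in> polys n"
  using Poly_Mapping.keys_add[of p q] unfolding polys_def by blast

lemma polys_mult: "p \<in> polys n \<Longrightarrow> q \<in> polys n \<Longrightarrow> (p * q :: 'k::comm_ring_1 mpoly) \<in> polys n"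
  using keys_mult[of p q] unfolding polys_def by (fastforce simp: keys_plus_nat)

lemma polys_uminus: "p \<in> polys n \<Longrightarrow> (- p :: 'k::comm_ring_1 mpoly) \<in> polys n"
  unfolding polys_def by (auto simp: in_keys_iff)

lemma polys_diff: "p \<in> polys n \<Longrightarrow> q \<in> polys n \<Longrightarrow> (p - q :: 'k::comm_ring_1 mpoly) \<in> polys n"
  using polys_add[of p n "- q"] polys_uminus[of q n] by simp

lemma polys_prod: "(\<And>i. i \<in> A \<Longrightarrow> p i \<in> polys n) \<Longrightarrow> (\<Prod>i\<in>A. p i :: 'k::comm_ring_1 mpoly) \<in> polys n"
  by (induction A rule: infinite_finite_induct) (auto simp: polys_mult)

lemma polys_sum: "(\<And>i. i \<in> A \<Longrightarrow> f i \<in> polys n) \<Longrightarrow> (sum f A :: 'k::comm_ring_1 mpoly) \<in> polys n"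
  by (induction A rule: infinite_finite_induct) (auto simp: polys_add)

lemma const_simps [simp]:
  "const (0 :: 'k::comm_ring_1) = 0" "const (1 :: 'k) = 1"
  "const (a + b :: 'k) = const a + const b" "const (- a :: 'k) = - const a"
  "const (a - b :: 'k) = const a - const b" "const (a * b :: 'k) = const a * const b"
  by (simp_all add: const_def single_add single_uminus single_diff mult_single)

lemma sum_monomials:
  "(\<Sum>m\<in>Poly_Mapping.keys p. Poly_Mapping.single m (Poly_Mapping.lookup p m)) = p"
  by (intro poly_mapping_eqI) (simp add: lookup_sum lookup_single when_def in_keys_iff)

text \<open>Induction on the total degree: a nonconstant monomial is divisible by some
  \<open>var j\<close>, and dividing by it lowers the sum of the exponents by one.\<close>

lemma single_in_polys_induct [consumes 1, case_names const var]:
  fixes P :: "'k::comm_ring_1 mpoly \<Rightarrow> bool"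
  assumes "Poly_Mapping.keys m \<subseteq> {..<n}"
    and const: "\<And>c. P (const c)"
    and var: "\<And>p j. p \<in> polys n \<Longrightarrow> P p \<Longrightarrow> j < n \<Longrightarrow> P (var j * p)"
  shows "P (Poly_Mapping.single m c)"
  using assms(1)
proof (induction "\<Sum>j<n. Poly_Mapping.lookup m j" arbitrary: m)
  case 0
  then have "m = 0"
    by (intro poly_mapping_eqI) (auto simp: in_keys_iff subset_iff)
  then show ?case using const[of c] by (simp add: const_def)
next
  case (Suc s)
  then obtain j where j: "j < n" "Poly_Mapping.lookup m j > 0"
    by (metis lessThan_iff nat.distinct(1) neq0_conv sum.neutral)
  define m' where "m' = m - Poly_Mapping.single j 1"
  have m: "m = Poly_Mapping.single j 1 + m'"
    using j by (intro poly_mapping_eqI) (auto simp: m'_def lookup_add lookup_minus lookup_single when_def)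
  have keys: "Poly_Mapping.keys m' \<subseteq> {..<n}"
    using Suc.prems unfolding m keys_plus_nat by blast
  have "(\<Sum>i<n. Poly_Mapping.lookup m i) = (\<Sum>i<n. if i = j then 1 else 0) + (\<Sum>i<n. Poly_Mapping.lookup m' i)"
    unfolding m by (simp add: lookup_add lookup_single when_def sum.distrib eq_commute)
  then have "s = (\<Sum>i<n. Poly_Mapping.lookup m' i)"
    using Suc.hyps(2) j by simp
  then have "P (Poly_Mapping.single m' c)"
    using Suc.hyps(1) keys by blast
  then have "P (var j * Poly_Mapping.single m' c)"
    using j keys by (intro var) (auto simp: polys_def)
  then show ?case
    by (simp add: var_def mult_single m)
qed

text \<open>A polynomial is the sum of its monomials. The only product to treat is that by a single
  variable, which suits maps that are known on generators.\<close>

lemma polys_induct [consumes 1, case_names const add var]: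
  fixes P :: "'k::comm_ring_1 mpoly \<Rightarrow> bool"
  assumes p: "p \<in> polys n"
    and const: "\<And>c. P (const c)"
    and add: "\<And>p q. p \<in> polys n \<Longrightarrow> P p \<Longrightarrow> q \<in> polys n \<Longrightarrow> P q \<Longrightarrow> P (p + q)"
    and var: "\<And>p j. p \<in> polys n \<Longrightarrow> P p \<Longrightarrow> j < n \<Longrightarrow> P (var j * p)"
  shows "P p"
proof -
  have "(\<Sum>m\<in>A. Poly_Mapping.single m (Poly_Mapping.lookup p m)) \<in> polys n \<and>
        P (\<Sum>m\<in>A. Poly_Mapping.single m (Poly_Mapping.lookup p m))"
    if "finite A" "A \<subseteq> Poly_Mapping.keys p" for A
    using that
  proof (induction A)
    case empty
    then show ?case using const[of 0] by simp
  next
    case (insert m A)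
    then have m: "Poly_Mapping.keys m \<subseteq> {..<n}"
      using p by (auto simp: polys_def)
    then have "Poly_Mapping.single m (Poly_Mapping.lookup p m) \<in> polys n"
      by (auto simp: polys_def)
    moreover have "P (Poly_Mapping.single m (Poly_Mapping.lookup p m))"
      using m const var by (rule single_in_polys_induct)
    ultimately show ?case
      using insert by (auto intro: add polys_add)
  qed
  from this[of "Poly_Mapping.keys p"] show ?thesis
    by (simp add: sum_monomials)
qed

lemma mem_polys_ex: "\<exists>n. p \<in> polys n"
proof -
  have "finite (\<Union>m\<in>Poly_Mapping.keys p. Poly_Mapping.keys m)" by simp
  then obtain n where "(\<Union>m\<in>Poly_Mapping.keys p. Poly_Mapping.keys m) \<subseteq> {..<n}"
    using finite_nat_iff_bounded by blast
  then show ?thesis by (auto simp: polys_def)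
qed

section \<open>Evaluation homomorphisms\<close>

text \<open>The coefficient map \<open>h\<close> stays general for two uses: \<open>const\<close>
  gives substitution of polynomials for the variables, the identity gives the value at a
  point.\<close>

definition mpoly_eval :: "('k::comm_ring_1 \<Rightarrow> 'r::comm_ring_1) \<Rightarrow> (nat \<Rightarrow> 'r) \<Rightarrow> 'k mpoly \<Rightarrow> 'r" where
  "mpoly_eval h s p = (\<Sum>m\<in>Poly_Mapping.keys p. h (Poly_Mapping.lookup p m) * (\<Prod>j\<in>Poly_Mapping.keys m. s j ^ Poly_Mapping.lookup m j))"

locale coeff_hom =
  fixes h :: "'k::comm_ring_1 \<Rightarrow> 'r::comm_ring_1"
  assumes h_simps: "h 1 = 1" "h 0 = 0" "h (a + b) = h a + h b" "h (a * b) = h a * h b"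
begin

context
  notes [simp] = h_simps
begin

lemma eval_const [simp]: "mpoly_eval h s (const c) = h c"
  by (simp add: mpoly_eval_def const_def)

lemma eval_0 [simp]: "mpoly_eval h s 0 = 0"
  by (simp add: mpoly_eval_def)

lemma eval_1 [simp]: "mpoly_eval h s 1 = 1"
  using eval_const[of s 1] by simp

lemma eval_var [simp]: "mpoly_eval h s (var j) = s j"
  by (simp add: mpoly_eval_def var_def)

lemma eval_add [simp]: "mpoly_eval h s (p + q) = mpoly_eval h s p + mpoly_eval h s q"
  unfolding mpoly_eval_def
  by (rule setsum_keys_plus_distrib) (auto simp: algebra_simps)

lemma eval_var_mult: "mpoly_eval h s (var j * p) = s j * mpoly_eval h s p"
proof -
  have monomial: "mpoly_eval h s (var j * Poly_Mapping.single m c) = s j * mpoly_eval h s (Poly_Mapping.single m c)" for m c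
  proof -
    \<comment> \<open>Multiplying by \<open>var j\<close> may enlarge the set of keys, so the
      products are compared over the larger index set; an index outside the keys has exponent 0 and
      contributes 1.\<close>
    have "(\<Prod>i\<in>insert j (Poly_Mapping.keys m). s i ^ (Poly_Mapping.lookup (Poly_Mapping.single j 1) i + Poly_Mapping.lookup m i))
      = s j * (\<Prod>i\<in>insert j (Poly_Mapping.keys m). s i ^ Poly_Mapping.lookup m i)"
      by (cases "j \<in> Poly_Mapping.keys m")
         (auto simp: prod.insert_remove lookup_single when_def mult.assoc in_keys_iff intro!: prod.cong arg_cong2[where f="(*)"])
    also have "(\<Prod>i\<in>insert j (Poly_Mapping.keys m). s i ^ Poly_Mapping.lookup m i) = (\<Prod>i\<in>Poly_Mapping.keys m. s i ^ Poly_Mapping.lookup m i)"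
      by (rule prod.mono_neutral_right) (auto simp: in_keys_iff)
    finally show ?thesis
      by (cases "c = 0") (auto simp: var_def mult_single mpoly_eval_def keys_plus_nat lookup_add)
  qed
  have "mpoly_eval h s (var j * (\<Sum>m\<in>A. Poly_Mapping.single m (Poly_Mapping.lookup p m)))
     = s j * mpoly_eval h s (\<Sum>m\<in>A. Poly_Mapping.single m (Poly_Mapping.lookup p m))" for A
    by (induction A rule: infinite_finite_induct) (auto simp: monomial algebra_simps)
  from this[of "Poly_Mapping.keys p"] show ?thesis
    by (simp add: sum_monomials)
qed

lemma eval_const_mult: "mpoly_eval h s (const c * p) = h c * mpoly_eval h s p"
proof -
  have monomial: "mpoly_eval h s (const c * Poly_Mapping.single m a) = h c * mpoly_eval h s (Poly_Mapping.single m a)" for m a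
    by (auto simp: const_def mult_single mpoly_eval_def mult.assoc) (metis h_simps(2,4) mult.assoc mult_zero_left)
  have "mpoly_eval h s (const c * (\<Sum>m\<in>A. Poly_Mapping.single m (Poly_Mapping.lookup p m)))
     = h c * mpoly_eval h s (\<Sum>m\<in>A. Poly_Mapping.single m (Poly_Mapping.lookup p m))" for A
    by (induction A rule: infinite_finite_induct) (auto simp: monomial algebra_simps)
  from this[of "Poly_Mapping.keys p"] show ?thesis
    by (simp add: sum_monomials)
qed

lemma eval_mult [simp]: "mpoly_eval h s (p * q) = mpoly_eval h s p * mpoly_eval h s q"
proof -
  obtain n where "p \<in> polys n" using mem_polys_ex by blast
  then show ?thesis
    by (induction rule: polys_induct) (auto simp: eval_const_mult eval_var_mult distrib_right mult.assoc)
qed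

lemma eval_uminus [simp]: "mpoly_eval h s (- p) = - mpoly_eval h s p"
proof -
  have "mpoly_eval h s (p + - p) = 0" by simp
  then show ?thesis
    using eval_add[of s p "- p"] by (simp add: add_eq_0_iff)
qed

lemma eval_diff [simp]: "mpoly_eval h s (p - q) = mpoly_eval h s p - mpoly_eval h s q"
  using eval_add[of s p "- q"] by simp

lemma eval_prod: "mpoly_eval h s (\<Prod>i\<in>A. p i) = (\<Prod>i\<in>A. mpoly_eval h s (p i))"
  by (induction A rule: infinite_finite_induct) auto

lemma eval_sum: "mpoly_eval h s (\<Sum>i\<in>A. p i) = (\<Sum>i\<in>A. mpoly_eval h s (p i))"
  by (induction A rule: infinite_finite_induct) auto

end

end

section \<open>Coordinates on a quotient\<close>

lemma sum_fun_apply: "(\<Sum>i\<in>A. f i) x = (\<Sum>i\<in>A. f i x :: 'a::comm_monoid_add)"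
  by (induction A rule: infinite_finite_induct) auto

definition lincomb :: "nat \<Rightarrow> (nat \<Rightarrow> 'k::comm_ring_1) \<Rightarrow> (nat \<Rightarrow> nat \<Rightarrow> 'k mpoly) \<Rightarrow> nat \<Rightarrow> 'k mpoly" where
  "lincomb d c b = (\<Sum>i<d. mscale (const (c i)) (b i))"

definition free_gen :: "nat \<Rightarrow> nat \<Rightarrow> 'k::comm_ring_1 mpoly" where
  "free_gen k = (\<lambda>i. if i = k then 1 else 0)"

lemma mscale_simps [simp]:
  "mscale p (f + g) = mscale p f + mscale p g" "mscale (p + q) f = mscale p f + mscale q f"
  "mscale p (mscale q f) = mscale (p * q) f" "mscale 1 f = f" "mscale 0 f = 0" "mscale p 0 = 0"
  "mscale (- p) f = - mscale p f" "mscale p (- f) = - mscale p f"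
  "mscale p (f - g) = mscale p f - mscale p g" "mscale (p - q) f = mscale p f - mscale q f"
  by (simp_all add: mscale_def fun_eq_iff algebra_simps)

lemma mscale_sum: "mscale p (sum f A) = (\<Sum>i\<in>A. mscale p (f i))"
  by (simp add: mscale_def fun_eq_iff sum_fun_apply sum_distrib_left)

lemma lincomb_add: "lincomb d (\<lambda>i. c i + c' i) b = lincomb d c b + lincomb d c' b"
  by (simp add: lincomb_def sum.distrib)

lemma lincomb_scale: "lincomb d (\<lambda>i. a * c i) b = mscale (const a) (lincomb d c b)"
  by (simp add: lincomb_def mscale_sum)

lemma lincomb_delta: "k < d \<Longrightarrow> lincomb d (\<lambda>i. if i = k then 1 else 0) b = b k"
proof -
  assume "k < d"
  have "lincomb d (\<lambda>i. if i = k then 1 else 0) b = (\<Sum>i<d. if i = k then b i else 0)"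
    unfolding lincomb_def by (rule sum.cong) auto
  then show ?thesis using \<open>k < d\<close> by simp
qed

lemma free_mod_add: "f \<in> free_mod n r \<Longrightarrow> g \<in> free_mod n r \<Longrightarrow> (f + g :: nat \<Rightarrow> 'k::comm_ring_1 mpoly) \<in> free_mod n r"
  by (auto simp: free_mod_def polys_add)

lemma free_mod_mscale: "p \<in> polys n \<Longrightarrow> f \<in> free_mod n r \<Longrightarrow> mscale p f \<in> free_mod n r"
  by (auto simp: free_mod_def polys_mult mscale_def)

lemma free_mod_uminus: "f \<in> free_mod n r \<Longrightarrow> (- f :: nat \<Rightarrow> 'k::comm_ring_1 mpoly) \<in> free_mod n r"
  by (auto simp: free_mod_def polys_uminus)

lemma free_mod_diff: "f \<in> free_mod n r \<Longrightarrow> g \<in> free_mod n r \<Longrightarrow> (f - g :: nat \<Rightarrow> 'k::comm_ring_1 mpoly) \<in> free_mod n r"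
  using free_mod_add[of f n r "- g"] free_mod_uminus[of g n r] by simp

lemma free_mod_0 [simp]: "(0 :: nat \<Rightarrow> 'k::comm_ring_1 mpoly) \<in> free_mod n r"
  by (simp add: free_mod_def)

lemma free_mod_sum: "(\<And>i. i \<in> A \<Longrightarrow> f i \<in> free_mod n r) \<Longrightarrow> (sum f A :: nat \<Rightarrow> 'k::comm_ring_1 mpoly) \<in> free_mod n r"
  by (induction A rule: infinite_finite_induct) (auto simp: free_mod_add)

lemma free_gen_in_free_mod: "k < r \<Longrightarrow> (free_gen k :: nat \<Rightarrow> 'k::comm_ring_1 mpoly) \<in> free_mod n r"
  by (auto simp: free_mod_def free_gen_def)

lemma lincomb_in_free_mod: "(\<And>i. i < d \<Longrightarrow> b i \<in> free_mod n r) \<Longrightarrow> lincomb d c b \<in> free_mod n r"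
  unfolding lincomb_def by (intro free_mod_sum free_mod_mscale) auto

lemma free_mod_eq_sum:
  assumes "f \<in> free_mod n r"
  shows "f = (\<Sum>k<r. mscale (f k) (free_gen k))"
proof
  fix i
  have "(\<Sum>k<r. mscale (f k) (free_gen k)) i = (\<Sum>k<r. if k = i then f i else 0)"
    unfolding sum_fun_apply by (rule sum.cong) (auto simp: mscale_def free_gen_def)
  then show "f i = (\<Sum>k<r. mscale (f k) (free_gen k)) i"
    using assms by (auto simp: free_mod_def)
qed

lemma free_mod_induct [consumes 1, case_names gen const add var zero]:
  fixes P :: "(nat \<Rightarrow> 'k::comm_ring_1 mpoly) \<Rightarrow> bool"
  assumes f: "f \<in> free_mod n r"
    and gen: "\<And>k. k < r \<Longrightarrow> P (free_gen k)"
    and const: "\<And>f c. f \<in> free_mod n r \<Longrightarrow> P f \<Longrightarrow> P (mscale (const c) f)"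
    and add: "\<And>f g. f \<in> free_mod n r \<Longrightarrow> P f \<Longrightarrow> g \<in> free_mod n r \<Longrightarrow> P g \<Longrightarrow> P (f + g)"
    and var: "\<And>f j. f \<in> free_mod n r \<Longrightarrow> P f \<Longrightarrow> j < n \<Longrightarrow> P (mscale (var j) f)"
    and zero: "P 0"
  shows "P f"
proof -
  have 1: "P (mscale p (free_gen k))" if "p \<in> polys n" "k < r" for p k
    using that
  proof (induction rule: polys_induct)
    case (const c)
    then show ?case by (intro assms(3)) (auto simp: gen free_gen_in_free_mod)
  next
    case (add p q)
    then show ?case
      unfolding mscale_simps by (intro assms(4) free_mod_mscale free_gen_in_free_mod)
  next
    case (var p j)
    then have "P (mscale (var j) (mscale p (free_gen k)))"
      by (intro assms(5) free_mod_mscale free_gen_in_free_mod) auto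
    then show ?case by simp
  qed
  have "P (\<Sum>k\<in>A. mscale (f k) (free_gen k))" if "finite A" "A \<subseteq> {..<r}" for A
    using that
  proof (induction A)
    case empty
    show ?case unfolding sum.empty by (rule zero)
  next
    case (insert k A)
    moreover have "f k \<in> polys n" if "k < r" for k
      using f that by (auto simp: free_mod_def)
    ultimately show ?case
      unfolding sum.insert[OF insert(1,2)]
      by (intro add 1 free_mod_mscale free_mod_sum free_gen_in_free_mod) auto
  qed
  from this[of "{..<r}"] show ?thesis
    using free_mod_eq_sum[OF f] by simp
qed

text \<open>The two assumptions say that \<open>K\<close> is a point of the chart of
  \<open>b\<close>; coordinates are then a linear map on the free module with kernel
  \<open>K\<close>.\<close>

locale quot_point =
  fixes n r d :: nat and b :: "nat \<Rightarrow> nat \<Rightarrow> 'k::field mpoly" and K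
  assumes submod: "is_submod n r K" and basis: "quot_basis n r d b K"
begin

lemma K_sub: "f \<in> K \<Longrightarrow> f \<in> free_mod n r"
  using submod by (auto simp: is_submod_def)

lemma K_0 [simp]: "0 \<in> K"
  using submod by (auto simp: is_submod_def)

lemma K_add: "f \<in> K \<Longrightarrow> g \<in> K \<Longrightarrow> f + g \<in> K"
  using submod by (auto simp: is_submod_def)

lemma K_mscale: "p \<in> polys n \<Longrightarrow> f \<in> K \<Longrightarrow> mscale p f \<in> K"
  using submod by (auto simp: is_submod_def)

lemma K_uminus: "f \<in> K \<Longrightarrow> - f \<in> K"
  using K_mscale[of "- 1" f] by (simp add: polys_uminus)

lemma K_diff: "f \<in> K \<Longrightarrow> g \<in> K \<Longrightarrow> f - g \<in> K"
  using K_add[of f "- g"] K_uminus[of g] by simp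

lemma K_sum: "(\<And>i. i \<in> A \<Longrightarrow> f i \<in> K) \<Longrightarrow> sum f A \<in> K"
  by (induction A rule: infinite_finite_induct) (auto intro: K_add)

lemma basis_in: "i < d \<Longrightarrow> b i \<in> free_mod n r"
  using basis by (auto simp: quot_basis_def)

abbreviation "co \<equiv> quot_coords d b K"

lemma co_ex1: "f \<in> free_mod n r \<Longrightarrow> \<exists>!c. (\<forall>i\<ge>d. c i = 0) \<and> f - lincomb d c b \<in> K"
  using basis by (auto simp: quot_basis_def lincomb_def)

lemma co_props: "f \<in> free_mod n r \<Longrightarrow> (\<forall>i\<ge>d. co f i = 0) \<and> f - lincomb d (co f) b \<in> K"
  using theI'[OF co_ex1] unfolding quot_coords_def lincomb_def by blast

lemma co_rem: "f \<in> free_mod n r \<Longrightarrow> f - lincomb d (co f) b \<in> K"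
  using co_props by blast

lemma co_ge: "f \<in> free_mod n r \<Longrightarrow> i \<ge> d \<Longrightarrow> co f i = 0"
  using co_props by blast

lemma co_eqI:
  assumes "f \<in> free_mod n r" "\<And>i. i \<ge> d \<Longrightarrow> c i = 0" "f - lincomb d c b \<in> K"
  shows "co f = c"
  using co_ex1[OF assms(1)] co_props[OF assms(1)] assms by blast

lemma co_add: "f \<in> free_mod n r \<Longrightarrow> g \<in> free_mod n r \<Longrightarrow> co (f + g) = (\<lambda>i. co f i + co g i)"
  using K_add[OF co_rem co_rem, of f g]
  by (intro co_eqI) (auto simp: free_mod_add co_ge lincomb_add algebra_simps)

lemma co_scale: "f \<in> free_mod n r \<Longrightarrow> co (mscale (const a) f) = (\<lambda>i. a * co f i)"
  using K_mscale[OF _ co_rem, of "const a" f]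
  by (intro co_eqI) (auto simp: free_mod_mscale co_ge lincomb_scale algebra_simps)

lemma co_K: "f \<in> K \<Longrightarrow> co f = (\<lambda>i. 0)"
  by (intro co_eqI) (auto simp: K_sub lincomb_def)

lemma co_0: "co 0 = (\<lambda>i. 0)"
  by (simp add: co_K)

lemma co_eq_0_iff: "f \<in> free_mod n r \<Longrightarrow> co f = (\<lambda>i. 0) \<longleftrightarrow> f \<in> K"
  using co_rem[of f] co_K[of f] by (auto simp: lincomb_def)

lemma co_diff: "f \<in> free_mod n r \<Longrightarrow> g \<in> free_mod n r \<Longrightarrow> co (f - g) = (\<lambda>i. co f i - co g i)"
  using co_add[of f "mscale (const (- 1)) g"] co_scale[of g "- 1"] free_mod_uminus[of g n r] by simp

lemma co_cong: "f \<in> free_mod n r \<Longrightarrow> g \<in> free_mod n r \<Longrightarrow> f - g \<in> K \<Longrightarrow> co f = co g"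
  using co_diff[of f g] co_K[of "f - g"] by (auto simp: fun_eq_iff)

lemma co_basis: "k < d \<Longrightarrow> co (b k) = (\<lambda>i. if i = k then 1 else 0)"
  by (intro co_eqI) (auto simp: basis_in lincomb_delta)

lemma co_sum: "(\<And>i. i \<in> A \<Longrightarrow> f i \<in> free_mod n r) \<Longrightarrow> co (sum f A) = (\<lambda>k. \<Sum>i\<in>A. co (f i) k)"
  by (induction A rule: infinite_finite_induct) (auto simp: co_0 co_add free_mod_sum)

lemma co_lincomb:
  assumes "\<And>j. j < m \<Longrightarrow> g j \<in> free_mod n r"
  shows "co (lincomb m c g) i = (\<Sum>j<m. c j * co (g j) i)"
  unfolding lincomb_def using assms by (subst co_sum) (auto simp: co_scale free_mod_mscale)

text \<open>As \<open>K\<close> is a submodule, replacing \<open>f\<close> by the combination of the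
  \<open>b k\<close> with the same class changes \<open>mscale p f\<close> only by an element of
  \<open>K\<close>. So \<open>p\<close> acts on coordinates through a matrix.\<close>

lemma co_mscale:
  assumes p: "p \<in> polys n" and f: "f \<in> free_mod n r"
  shows "co (mscale p f) i = (\<Sum>k<d. co f k * co (mscale p (b k)) i)"
proof -
  have "mscale p f - mscale p (lincomb d (co f) b) \<in> K"
    using K_mscale[OF p co_rem[OF f]] by simp
  then have "co (mscale p f) = co (mscale p (lincomb d (co f) b))"
    using p f by (intro co_cong free_mod_mscale lincomb_in_free_mod) (auto simp: basis_in)
  also have "mscale p (lincomb d (co f) b) = (\<Sum>k<d. mscale (const (co f k)) (mscale p (b k)))"
    by (simp add: lincomb_def mscale_sum mult.commute)
  also have "co \<dots> = (\<lambda>i. \<Sum>k<d. co f k * co (mscale p (b k)) i)"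
    using p by (subst co_sum) (auto simp: co_scale free_mod_mscale basis_in simp del: mscale_simps)
  finally show ?thesis by simp
qed

lemma co_var:
  "j < n \<Longrightarrow> f \<in> free_mod n r \<Longrightarrow> i < d \<Longrightarrow>
    co (mscale (var j) f) i = (\<Sum>k<d. co f k * mult_matrix d b K j (i, k))"
  by (subst co_mscale) (auto simp: mult_matrix_def)

end

lemma chart_quot_point: "K \<in> chart n r d b \<Longrightarrow> quot_point n r d b K"
  by (auto simp: chart_def quot_points_def quot_point_def)

lemma quot_point_chart: "quot_point n r d b K \<Longrightarrow> K \<in> chart n r d b"
  by (auto simp: chart_def quot_points_def quot_point_def)

section \<open>Principal open subsets of a chart\<close>

text \<open>The matrix is given by an entry function, so that a determinant whose entries depend on
  \<open>K\<close> can itself be treated as a function of \<open>K\<close>.\<close>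

definition fun_det :: "nat \<Rightarrow> (nat \<Rightarrow> nat \<Rightarrow> 'k::comm_ring_1) \<Rightarrow> 'k" where
  "fun_det d B = Determinant.det (Matrix.mat d d (\<lambda>(i, j). B i j))"

lemma fun_det_expand:
  "fun_det d B = (\<Sum>p | p permutes {0..<d}. signof p * (\<Prod>i = 0..<d. B i (p i)))"
proof -
  have "(\<Prod>i = 0..<d. Matrix.mat d d (\<lambda>(i, j). B i j) $$ (i, p i)) = (\<Prod>i = 0..<d. B i (p i))"
    if "p permutes {0..<d}" for p
    using permutes_in_image[OF that] by (intro prod.cong) auto
  then show ?thesis
    unfolding fun_det_def by (subst det_def'[of _ d]) auto
qed

text \<open>Cramer's rule in a form without division; it clears denominators when passing between
  charts.\<close>

lemma fun_det_cramer:
  fixes B :: "nat \<Rightarrow> nat \<Rightarrow> 'k::comm_ring_1"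
  assumes k: "k < d" and c: "\<And>i. i < d \<Longrightarrow> c i = (\<Sum>j<d. B i j * x j)"
  shows "fun_det d (\<lambda>i j. if j = k then c i else B i j) = x k * fun_det d B"
proof -
  let ?B = "Matrix.mat d d (\<lambda>(i, j). B i j)" and ?x = "Matrix.vec d x"
  have "replace_col ?B (?B *\<^sub>v ?x) k = Matrix.mat d d (\<lambda>(i, j). if j = k then c i else B i j)"
    by (rule eq_matI) (auto simp: replace_col_def c scalar_prod_def lessThan_atLeast0)
  then show ?thesis
    using cramer_lemma_mat[of ?B d ?x k] k by (simp add: fun_det_def)
qed

lemma fun_det_nonzero:
  fixes B :: "nat \<Rightarrow> nat \<Rightarrow> 'k::field"
  assumes "\<And>i j. i < d \<Longrightarrow> j < d \<Longrightarrow> (\<Sum>k<d. B i k * B' k j) = (if i = j then 1 else 0)"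
  shows "fun_det d B \<noteq> 0"
proof -
  let ?B = "Matrix.mat d d (\<lambda>(i, j). B i j)" and ?B' = "Matrix.mat d d (\<lambda>(i, j). B' i j)"
  have "?B * ?B' = 1\<^sub>m d"
    by (rule eq_matI) (auto simp: scalar_prod_def assms lessThan_atLeast0[symmetric])
  then have "Determinant.det ?B * Determinant.det ?B' = 1"
    by (metis det_mult det_one mat_carrier)
  then show ?thesis by (auto simp: fun_det_def)
qed

lemma fun_det_inverse:
  fixes B :: "nat \<Rightarrow> nat \<Rightarrow> 'k::field"
  assumes "fun_det d B \<noteq> 0"
  obtains B' where
    "\<And>i j. i < d \<Longrightarrow> j < d \<Longrightarrow> (\<Sum>k<d. B i k * B' k j) = (if i = j then 1 else 0)"
    "\<And>i j. i < d \<Longrightarrow> j < d \<Longrightarrow> (\<Sum>k<d. B' i k * B k j) = (if i = j then 1 else 0)"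
proof -
  let ?B = "Matrix.mat d d (\<lambda>(i, j). B i j)"
  have "?B \<in> carrier_mat d d" by simp
  note adj = adj_mat[OF this]
  have nz: "Determinant.det ?B \<noteq> 0" using assms by (simp add: fun_det_def)
  define B' where "B' i j = adj_mat ?B $$ (i, j) / Determinant.det ?B" for i j
  show ?thesis
  proof
    fix i j assume ij: "i < d" "j < d"
    have "(?B * adj_mat ?B) $$ (i, j) = (\<Sum>k<d. B i k * adj_mat ?B $$ (k, j))"
      using adj(1) ij by (simp add: scalar_prod_def lessThan_atLeast0)
    then show "(\<Sum>k<d. B i k * B' k j) = (if i = j then 1 else 0)"
      using ij nz unfolding adj(2) B'_def
      by (cases "i = j") (simp_all add: divide_simps flip: sum_divide_distrib)
    have "(adj_mat ?B * ?B) $$ (i, j) = (\<Sum>k<d. adj_mat ?B $$ (i, k) * B k j)"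
      using adj(1) ij by (simp add: scalar_prod_def lessThan_atLeast0)
    then show "(\<Sum>k<d. B' i k * B k j) = (if i = j then 1 else 0)"
      using ij nz unfolding adj(3) B'_def
      by (cases "i = j") (simp_all add: divide_simps flip: sum_divide_distrib)
  qed
qed

lemma chart_ring_sum:
  "(\<And>i. i \<in> A \<Longrightarrow> g i \<in> chart_ring n r d b) \<Longrightarrow> (\<lambda>K. \<Sum>i\<in>A. g i K) \<in> chart_ring n r d b"
  by (induction A rule: infinite_finite_induct) (auto intro: chart_ring.intros)

lemma chart_ring_prod:
  "(\<And>i. i \<in> A \<Longrightarrow> g i \<in> chart_ring n r d b) \<Longrightarrow> (\<lambda>K. \<Prod>i\<in>A. g i K) \<in> chart_ring n r d b"
  by (induction A rule: infinite_finite_induct) (auto intro: chart_ring.intros)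

lemma chart_ring_power: "g \<in> chart_ring n r d b \<Longrightarrow> (\<lambda>K. g K ^ N) \<in> chart_ring n r d b"
  by (induction N) (auto intro: chart_ring.intros)

lemma chart_ring_fun_det:
  assumes "\<And>i j. i < d' \<Longrightarrow> j < d' \<Longrightarrow> (\<lambda>K. B K i j) \<in> chart_ring n r d b"
  shows "(\<lambda>K. fun_det d' (B K)) \<in> chart_ring n r d b"
  unfolding fun_det_expand
proof (intro chart_ring_sum chart_ring.mult chart_ring.const chart_ring_prod)
  fix p i assume "p \<in> {p. p permutes {0..<d'}}" "i \<in> {0..<d'}"
  then show "(\<lambda>K. B K i (p i)) \<in> chart_ring n r d b"
    using permutes_in_image[of p "{0..<d'}" i] by (intro assms) auto
qed

text \<open>Determinant of the change of basis. For \<open>b'\<close> in the free module, its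
  nonvanishing locus in the chart of \<open>b\<close> is the intersection with the chart of
  \<open>b'\<close>.\<close>

definition change_det :: "nat \<Rightarrow> (nat \<Rightarrow> nat \<Rightarrow> 'k::comm_ring_1 mpoly) \<Rightarrow> (nat \<Rightarrow> nat \<Rightarrow> 'k mpoly) \<Rightarrow>
    (nat \<Rightarrow> 'k mpoly) set \<Rightarrow> 'k" where
  "change_det d b b' K = fun_det d (\<lambda>i j. quot_coords d b K (b' j) i)"

lemma change_det_chart_ring:
  "(\<And>j. j < d \<Longrightarrow> b' j \<in> free_mod n r) \<Longrightarrow> change_det d b b' \<in> chart_ring n r d b"
  unfolding change_det_def[abs_def] by (intro chart_ring_fun_det chart_ring.coord)

lemma coords_change:
  assumes "quot_point n r d b K" "quot_point n r d b' K" "f \<in> free_mod n r"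
  shows "quot_coords d b K f i = (\<Sum>j<d. quot_coords d b K (b' j) i * quot_coords d b' K f j)"
proof -
  interpret b: quot_point n r d b K by fact
  interpret b': quot_point n r d b' K by fact
  have "b.co f = b.co (lincomb d (b'.co f) b')"
    using assms(3) by (intro b.co_cong b'.co_rem lincomb_in_free_mod b'.basis_in)
  then show ?thesis
    by (simp add: b.co_lincomb b'.basis_in mult.commute)
qed

lemma change_det_nonzero:
  assumes "quot_point n r d b K" "quot_point n r d b' K"
  shows "change_det d b b' K \<noteq> (0 :: 'k::field)"
  unfolding change_det_def
proof (rule fun_det_nonzero[where B' = "\<lambda>i j. quot_coords d b' K (b j) i"])
  interpret b: quot_point n r d b K by fact
  fix i j assume "i < d" "j < d"
  then show "(\<Sum>k<d. quot_coords d b K (b' k) i * quot_coords d b' K (b j) k) = (if i = j then 1 else 0)"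
    using coords_change[OF assms b.basis_in, of j i] by (simp add: b.co_basis)
qed

text \<open>The inverse matrix \<open>B'\<close> converts coordinates for \<open>b\<close> into
  coordinates for \<open>b'\<close>: one of the two product identities yields existence, the other
  uniqueness.\<close>

lemma change_det_imp_basis:
  fixes b b' :: "nat \<Rightarrow> nat \<Rightarrow> 'k::field mpoly"
  assumes "quot_point n r d b K" "change_det d b b' K \<noteq> 0"
    and b': "\<And>j. j < d \<Longrightarrow> b' j \<in> free_mod n r"
  shows "quot_point n r d b' K"
proof -
  interpret quot_point n r d b K by fact
  let ?B = "\<lambda>i j. co (b' j) i"
  obtain B' where
    B: "\<And>i j. i < d \<Longrightarrow> j < d \<Longrightarrow> (\<Sum>k<d. ?B i k * B' k j) = (if i = j then 1 else 0)"
       "\<And>i j. i < d \<Longrightarrow> j < d \<Longrightarrow> (\<Sum>k<d. B' i k * ?B k j) = (if i = j then 1 else 0)"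
    using assms(2) unfolding change_det_def by (rule fun_det_inverse) (rule that)
  have ex1: "\<exists>!c. (\<forall>i\<ge>d. c i = 0) \<and> f - lincomb d c b' \<in> K" if f: "f \<in> free_mod n r" for f
  proof
    define c where "c i = (if i < d then \<Sum>j<d. B' i j * co f j else 0)" for i
    have "co (lincomb d c b') i = co f i" for i
    proof (cases "i < d")
      case True
      have "co (lincomb d c b') i = (\<Sum>k<d. \<Sum>j<d. (?B i k * B' k j) * co f j)"
        by (simp add: co_lincomb[OF b'] c_def sum_distrib_left mult_ac)
      also have "\<dots> = (\<Sum>j<d. (\<Sum>k<d. ?B i k * B' k j) * co f j)"
        by (subst sum.swap) (simp add: sum_distrib_right)
      also have "\<dots> = (\<Sum>j<d. if i = j then co f j else 0)"
        using True by (intro sum.cong) (auto simp: B)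
      finally show ?thesis using True by simp
    next
      case False
      then show ?thesis
        using f b' by (simp add: co_ge lincomb_in_free_mod)
    qed
    then have "co (f - lincomb d c b') = (\<lambda>i. 0)"
      using f b' by (simp add: co_diff lincomb_in_free_mod)
    then show "(\<forall>i\<ge>d. c i = 0) \<and> f - lincomb d c b' \<in> K"
      using f b' by (simp add: co_eq_0_iff free_mod_diff lincomb_in_free_mod c_def)
    fix c' assume c': "(\<forall>i\<ge>d. c' i = 0) \<and> f - lincomb d c' b' \<in> K"
    then have co: "co f = co (lincomb d c' b')"
      using f b' by (intro co_cong lincomb_in_free_mod) auto
    show "c' = c"
    proof
      fix i
      show "c' i = c i"
      proof (cases "i < d")
        case True
        have "c i = (\<Sum>j<d. B' i j * co (lincomb d c' b') j)"
          using True by (simp only: c_def co if_True)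
        also have "\<dots> = (\<Sum>j<d. \<Sum>k<d. (B' i j * ?B j k) * c' k)"
          by (simp only: co_lincomb[OF b'] sum_distrib_left mult_ac)
        also have "\<dots> = (\<Sum>k<d. (\<Sum>j<d. B' i j * ?B j k) * c' k)"
          by (subst sum.swap) (simp add: sum_distrib_right)
        also have "\<dots> = (\<Sum>k<d. if i = k then c' k else 0)"
          using True by (intro sum.cong) (auto simp: B)
        finally show ?thesis using True by simp
      next
        case False
        then show ?thesis using c' by (simp add: c_def)
      qed
    qed
  qed
  have "quot_basis n r d b' K"
    unfolding quot_basis_def lincomb_def[symmetric] by (intro conjI allI impI ballI b' ex1)
  then show ?thesis
    using submod by unfold_locales
qed

text \<open>By Cramer's rule a coordinate of the other chart is a quotient of regular functions with
  denominator \<open>change_det d b b'\<close>; sums and products only raise the power of the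
  denominator.\<close>

lemma chart_ring_change:
  fixes b b' :: "nat \<Rightarrow> nat \<Rightarrow> 'k::field mpoly"
  assumes "g' \<in> chart_ring n r d b'" and b': "\<And>j. j < d \<Longrightarrow> b' j \<in> free_mod n r"
  shows "\<exists>N. \<exists>g \<in> chart_ring n r d b. \<forall>K \<in> chart n r d b \<inter> chart n r d b'.
           g K = change_det d b b' K ^ N * g' K"
  using assms(1)
proof induction
  case (const a)
  then show ?case
    by (intro exI[of _ 0] bexI[OF _ chart_ring.const[of a]]) auto
next
  case (coord f k)
  let ?g = "\<lambda>K. fun_det d (\<lambda>i j. if j = k then quot_coords d b K f i else quot_coords d b K (b' j) i)"
  have "?g \<in> chart_ring n r d b"
  proof (rule chart_ring_fun_det)
    fix i j assume "i < d" "j < d"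
    then show "(\<lambda>K. if j = k then quot_coords d b K f i else quot_coords d b K (b' j) i) \<in> chart_ring n r d b"
      using chart_ring.coord[of f n r i d b] chart_ring.coord[of "b' j" n r i d b] coord b' by (cases "j = k") auto
  qed
  moreover have "?g K = change_det d b b' K ^ 1 * quot_coords d b' K f k"
    if "K \<in> chart n r d b \<inter> chart n r d b'" for K
    using that coord unfolding change_det_def
    by (subst fun_det_cramer) (auto intro: coords_change chart_quot_point)
  ultimately show ?case
    by (intro exI[of _ 1] bexI[of _ ?g] ballI)
next
  case (add g h)
  obtain N M g0 h0 where
    g: "g0 \<in> chart_ring n r d b" "\<forall>K \<in> chart n r d b \<inter> chart n r d b'. g0 K = change_det d b b' K ^ N * g K"
    and h: "h0 \<in> chart_ring n r d b" "\<forall>K \<in> chart n r d b \<inter> chart n r d b'. h0 K = change_det d b b' K ^ M * h K"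
    using add.IH by metis
  have "(\<lambda>K. change_det d b b' K ^ M * g0 K + change_det d b b' K ^ N * h0 K) \<in> chart_ring n r d b"
    by (intro chart_ring.add chart_ring.mult chart_ring_power change_det_chart_ring b' g h)
  moreover have "\<forall>K \<in> chart n r d b \<inter> chart n r d b'.
      change_det d b b' K ^ M * g0 K + change_det d b b' K ^ N * h0 K = change_det d b b' K ^ (N + M) * (g K + h K)"
    using g(2) h(2) by (auto simp: power_add algebra_simps)
  ultimately show ?case
    by (intro exI[of _ "N + M"]) (rule bexI)
next
  case (mult g h)
  obtain N M g0 h0 where
    g: "g0 \<in> chart_ring n r d b" "\<forall>K \<in> chart n r d b \<inter> chart n r d b'. g0 K = change_det d b b' K ^ N * g K"
    and h: "h0 \<in> chart_ring n r d b" "\<forall>K \<in> chart n r d b \<inter> chart n r d b'. h0 K = change_det d b b' K ^ M * h K"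
    using mult.IH by metis
  have "(\<lambda>K. g0 K * h0 K) \<in> chart_ring n r d b"
    by (intro chart_ring.mult g h)
  moreover have "\<forall>K \<in> chart n r d b \<inter> chart n r d b'. g0 K * h0 K = change_det d b b' K ^ (N + M) * (g K * h K)"
    using g(2) h(2) by (auto simp: power_add algebra_simps)
  ultimately show ?case
    by (intro exI[of _ "N + M"]) (rule bexI)
qed

text \<open>The topology is generated by principal open sets of all charts at once. That one chart
  carries the Zariski topology of its own ring is the content here, proved along the generation of
  \<open>U\<close>.\<close>

lemma Quot_open_nbhd:
  fixes b :: "nat \<Rightarrow> nat \<Rightarrow> 'k::field mpoly"
  assumes "openin (Quot n r d) U" "K \<in> U" "K \<in> chart n r d b"
  shows "\<exists>g \<in> chart_ring n r d b. g K \<noteq> 0 \<and> (\<forall>K' \<in> chart n r d b. g K' \<noteq> 0 \<longrightarrow> K' \<in> U)"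
proof -
  have "generate_topology_on {{K \<in> chart n r d b. g K \<noteq> 0} | b g. g \<in> chart_ring n r d b} U"
    using assms(1) unfolding Quot_def openin_topology_generated_by_iff .
  then have "\<forall>K \<in> U \<inter> chart n r d b. \<exists>g \<in> chart_ring n r d b. g K \<noteq> 0 \<and> (\<forall>K' \<in> chart n r d b. g K' \<noteq> 0 \<longrightarrow> K' \<in> U)"
  proof induction
    case Empty
    then show ?case by simp
  next
    case (Int U V)
    show ?case
    proof
      fix K assume K: "K \<in> (U \<inter> V) \<inter> chart n r d b"
      obtain g where g: "g \<in> chart_ring n r d b" "g K \<noteq> 0"
        "\<forall>K' \<in> chart n r d b. g K' \<noteq> 0 \<longrightarrow> K' \<in> U"
        using bspec[OF Int.IH(1), of K] K by auto
      obtain h where h: "h \<in> chart_ring n r d b" "h K \<noteq> 0"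
        "\<forall>K' \<in> chart n r d b. h K' \<noteq> 0 \<longrightarrow> K' \<in> V"
        using bspec[OF Int.IH(2), of K] K by auto
      from g h show "\<exists>g \<in> chart_ring n r d b. g K \<noteq> 0 \<and> (\<forall>K' \<in> chart n r d b. g K' \<noteq> 0 \<longrightarrow> K' \<in> U \<inter> V)"
        by (intro bexI[of _ "\<lambda>K. g K * h K"] chart_ring.mult) auto
    qed
  next
    case (UN \<U>)
    show ?case
    proof
      fix K assume "K \<in> \<Union>\<U> \<inter> chart n r d b"
      then obtain U where U: "U \<in> \<U>" "K \<in> U \<inter> chart n r d b"
        by blast
      obtain g where "g \<in> chart_ring n r d b" "g K \<noteq> 0"
        "\<forall>K' \<in> chart n r d b. g K' \<noteq> 0 \<longrightarrow> K' \<in> U"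
        using bspec[OF UN.IH[OF U(1)] U(2)] by (elim bexE conjE)
      then show "\<exists>g \<in> chart_ring n r d b. g K \<noteq> 0 \<and> (\<forall>K' \<in> chart n r d b. g K' \<noteq> 0 \<longrightarrow> K' \<in> \<Union>\<U>)"
        using U(1) by (intro bexI[of _ g]) auto
    qed
  next
    case (Basis U)
    then obtain b' g' where U: "U = {K \<in> chart n r d b'. g' K \<noteq> 0}" and g': "g' \<in> chart_ring n r d b'"
      by blast
    show ?case
    proof
      fix K assume K: "K \<in> U \<inter> chart n r d b"
      then have qp: "quot_point n r d b K" "quot_point n r d b' K"
        by (auto simp: U intro: chart_quot_point)
      then have b': "b' j \<in> free_mod n r" if "j < d" for j
        using quot_point.basis_in that by blast
      have "\<exists>N. \<exists>g \<in> chart_ring n r d b. \<forall>K \<in> chart n r d b \<inter> chart n r d b'.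
          g K = change_det d b b' K ^ N * g' K"
        by (rule chart_ring_change[OF g']) (rule b')
      then obtain N g where g: "g \<in> chart_ring n r d b"
        "\<forall>K \<in> chart n r d b \<inter> chart n r d b'. g K = change_det d b b' K ^ N * g' K"
        by (elim exE bexE)
      \<comment> \<open>The extra factor \<open>change_det d b b'\<close> forces a point where the
        product is nonzero into the chart of \<open>b'\<close>; only on the overlap is
        \<open>g\<close> related to \<open>g'\<close>.\<close>
      show "\<exists>g \<in> chart_ring n r d b. g K \<noteq> 0 \<and> (\<forall>K' \<in> chart n r d b. g K' \<noteq> 0 \<longrightarrow> K' \<in> U)"
      proof (intro bexI[of _ "\<lambda>K. change_det d b b' K * g K"] conjI ballI impI)
        show "change_det d b b' K * g K \<noteq> 0"
          using g(2) K change_det_nonzero[OF qp] by (auto simp: U)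
        show "(\<lambda>K. change_det d b b' K * g K) \<in> chart_ring n r d b"
          by (intro chart_ring.mult change_det_chart_ring g b')
        fix K' assume "K' \<in> chart n r d b" "change_det d b b' K' * g K' \<noteq> 0"
        moreover from this have "K' \<in> chart n r d b'"
          using b' by (auto intro: quot_point_chart change_det_imp_basis[OF chart_quot_point])
        ultimately show "K' \<in> U" using g(2) by (auto simp: U)
      qed
    qed
  qed
  then show ?thesis using assms(2,3) by (auto dest!: bspec[of _ _ K])
qed

lemma Quot_closed_separate:
  fixes b :: "nat \<Rightarrow> nat \<Rightarrow> 'k::field mpoly"
  assumes "closedin (Quot n r d) A" "K \<in> chart n r d b" "K \<notin> A"
  shows "\<exists>g \<in> chart_ring n r d b. g K \<noteq> 0 \<and> (\<forall>K' \<in> chart n r d b \<inter> A. g K' = 0)"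
proof -
  have "openin (Quot n r d) (quot_points n r d - A)"
    using assms(1) by (simp add: closedin_def topspace_Quot)
  moreover have "K \<in> quot_points n r d - A"
    using assms by (auto simp: chart_def)
  ultimately obtain g where "g \<in> chart_ring n r d b" "g K \<noteq> 0"
    and g: "\<forall>K' \<in> chart n r d b. g K' \<noteq> 0 \<longrightarrow> K' \<in> quot_points n r d - A"
    by (auto dest!: Quot_open_nbhd[OF _ _ assms(2)])
  moreover from g have "\<forall>K' \<in> chart n r d b \<inter> A. g K' = 0"
    by auto
  ultimately show ?thesis by auto
qed

lemma openin_chart_nonzero: "g \<in> chart_ring n r d b \<Longrightarrow> openin (Quot n r d) {K \<in> chart n r d b. g K \<noteq> 0}"
  unfolding Quot_def by (rule topology_generated_by_Basis) blast

lemma openin_chart: "openin (Quot n r d) (chart n r d (b :: nat \<Rightarrow> nat \<Rightarrow> 'k::field mpoly))"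
  using openin_chart_nonzero[OF chart_ring.const[of 1]] by simp

section \<open>Algebraic independence and counting monomials\<close>

text \<open>The generators may be arbitrary functions on a set; the later parameters of a point are
  not regular functions.\<close>

inductive_set gen_ring :: "('a \<Rightarrow> 'k::comm_ring_1) set \<Rightarrow> ('a \<Rightarrow> 'k) set" for W where
  const: "(\<lambda>x. a) \<in> gen_ring W"
| gen: "w \<in> W \<Longrightarrow> w \<in> gen_ring W"
| add: "g \<in> gen_ring W \<Longrightarrow> h \<in> gen_ring W \<Longrightarrow> (\<lambda>x. g x + h x) \<in> gen_ring W"
| mult: "g \<in> gen_ring W \<Longrightarrow> h \<in> gen_ring W \<Longrightarrow> (\<lambda>x. g x * h x) \<in> gen_ring W"

lemma gen_ring_sum:
  "(\<And>i. i \<in> A \<Longrightarrow> g i \<in> gen_ring W) \<Longrightarrow> (\<lambda>x. \<Sum>i\<in>A. g i x) \<in> gen_ring W"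
  by (induction A rule: infinite_finite_induct) (auto intro: gen_ring.intros)

lemma gen_ring_prod:
  "(\<And>i. i \<in> A \<Longrightarrow> g i \<in> gen_ring W) \<Longrightarrow> (\<lambda>x. \<Prod>i\<in>A. g i x) \<in> gen_ring W"
  by (induction A rule: infinite_finite_induct) (auto intro: gen_ring.intros)

lemma gen_ring_power: "g \<in> gen_ring W \<Longrightarrow> (\<lambda>x. g x ^ N) \<in> gen_ring W"
  by (induction N) (auto intro: gen_ring.intros)

definition fun_scale :: "'k::field \<Rightarrow> ('a \<Rightarrow> 'k) \<Rightarrow> 'a \<Rightarrow> 'k" where
  "fun_scale c g = (\<lambda>x. c * g x)"

interpretation fun_space: vector_space "fun_scale :: 'k::field \<Rightarrow> ('a \<Rightarrow> 'k) \<Rightarrow> 'a \<Rightarrow> 'k"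
  by unfold_locales (auto simp: fun_scale_def fun_eq_iff algebra_simps)

text \<open>Each exponent is bounded separately, so bounds add under multiplication and the number
  of exponent vectors is a plain power. Distinct exponents may give the same function, hence only
  upper bounds for the cardinality.\<close>

definition monomials :: "(nat \<Rightarrow> 'a \<Rightarrow> 'k::field) \<Rightarrow> nat \<Rightarrow> nat \<Rightarrow> ('a \<Rightarrow> 'k) set" where
  "monomials w D e = (\<lambda>\<beta> x. \<Prod>j<D. w j x ^ \<beta> j) ` (\<Pi>\<^sub>E j\<in>{..<D}. {..e})"

lemma finite_monomials: "finite (monomials w D e)"
  unfolding monomials_def by (intro finite_imageI finite_PiE) auto

lemma card_monomials: "card (monomials w D e) \<le> Suc e ^ D"
proof -
  have "card (monomials w D e) \<le> card (\<Pi>\<^sub>E j\<in>{..<D}. {..e})"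
    unfolding monomials_def by (intro card_image_le finite_PiE) auto
  then show ?thesis by (simp add: card_PiE)
qed

lemma monomialsI: "(\<And>j. j < D \<Longrightarrow> \<beta> j \<le> e) \<Longrightarrow> (\<lambda>x. \<Prod>j<D. w j x ^ \<beta> j) \<in> monomials w D e"
  unfolding monomials_def
  by (rule image_eqI[of _ _ "restrict \<beta> {..<D}"]) (auto intro!: prod.cong)

lemma monomials_mono: "e \<le> e' \<Longrightarrow> monomials w D e \<subseteq> monomials w D e'"
  unfolding monomials_def by (intro image_mono PiE_mono) auto

lemma monomials_mult:
  assumes "g \<in> monomials w D e" "h \<in> monomials w D e'"
  shows "(\<lambda>x. g x * h x) \<in> monomials w D (e + e')"
proof -
  obtain \<beta> \<gamma> where *: "g = (\<lambda>x. \<Prod>j<D. w j x ^ \<beta> j)" "h = (\<lambda>x. \<Prod>j<D. w j x ^ \<gamma> j)"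
    "\<beta> \<in> (\<Pi>\<^sub>E j\<in>{..<D}. {..e})" "\<gamma> \<in> (\<Pi>\<^sub>E j\<in>{..<D}. {..e'})"
    using assms by (auto simp: monomials_def)
  then have "(\<lambda>x. \<Prod>j<D. w j x ^ (\<beta> j + \<gamma> j)) \<in> monomials w D (e + e')"
    by (intro monomialsI add_mono) auto
  then show ?thesis by (simp add: * power_add prod.distrib)
qed

text \<open>Multiplication is bilinear and adds exponents; the two span inductions reduce one factor
  each to a monomial.\<close>

lemma span_monomials_mult:
  assumes g: "g \<in> fun_space.span (monomials w D e)" and h: "h \<in> fun_space.span (monomials w D e')"
  shows "(\<lambda>x. g x * h x) \<in> fun_space.span (monomials w D (e + e'))"
proof -
  let ?S = "fun_space.span (monomials w D (e + e'))"
  have mono: "(\<lambda>x. g x * h x) \<in> ?S" if "g \<in> monomials w D e" for g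
    using h
  proof (induction rule: fun_space.span_induct)
    case base
    show ?case
    proof (rule fun_space.subspaceI)
      show "0 \<in> {a. (\<lambda>x. g x * a x) \<in> ?S}"
        using fun_space.span_zero[of "monomials w D (e + e')"] by (simp add: zero_fun_def)
    next
      fix a b assume "a \<in> {a. (\<lambda>x. g x * a x) \<in> ?S}" "b \<in> {a. (\<lambda>x. g x * a x) \<in> ?S}"
      then show "a + b \<in> {a. (\<lambda>x. g x * a x) \<in> ?S}"
        using fun_space.span_add[of "\<lambda>x. g x * a x" _ "\<lambda>x. g x * b x"] by (simp add: plus_fun_def algebra_simps)
    next
      fix c a assume "a \<in> {a. (\<lambda>x. g x * a x) \<in> ?S}"
      then show "fun_scale c a \<in> {a. (\<lambda>x. g x * a x) \<in> ?S}"
        using fun_space.span_scale[of "\<lambda>x. g x * a x" _ c] by (simp add: fun_scale_def algebra_simps)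
    qed
  next
    case (step h)
    then show ?case using monomials_mult[OF that step] fun_space.span_base by blast
  qed
  show ?thesis
    using g
  proof (induction rule: fun_space.span_induct)
    case base
    show ?case
    proof (rule fun_space.subspaceI)
      show "0 \<in> {a. (\<lambda>x. a x * h x) \<in> ?S}"
        using fun_space.span_zero[of "monomials w D (e + e')"] by (simp add: zero_fun_def)
    next
      fix a b assume "a \<in> {a. (\<lambda>x. a x * h x) \<in> ?S}" "b \<in> {a. (\<lambda>x. a x * h x) \<in> ?S}"
      then show "a + b \<in> {a. (\<lambda>x. a x * h x) \<in> ?S}"
        using fun_space.span_add[of "\<lambda>x. a x * h x" _ "\<lambda>x. b x * h x"] by (simp add: plus_fun_def algebra_simps)
    next
      fix c a assume "a \<in> {a. (\<lambda>x. a x * h x) \<in> ?S}"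
      then show "fun_scale c a \<in> {a. (\<lambda>x. a x * h x) \<in> ?S}"
        using fun_space.span_scale[of "\<lambda>x. a x * h x" _ c] by (simp add: fun_scale_def algebra_simps)
    qed
  next
    case (step g)
    then show ?case by (rule mono)
  qed
qed

lemma span_monomials_mono:
  "g \<in> fun_space.span (monomials w D e) \<Longrightarrow> e \<le> e' \<Longrightarrow> g \<in> fun_space.span (monomials w D e')"
  using fun_space.span_mono[OF monomials_mono[of e e' w D]] by blast

lemma const_span_monomials: "(\<lambda>x. a) \<in> fun_space.span (monomials w D e)"
proof -
  have "(\<lambda>x. 1) \<in> monomials w D e"
    using monomialsI[of D "\<lambda>_. 0" e w] by simp
  then have "fun_scale a (\<lambda>x. 1) \<in> fun_space.span (monomials w D e)"
    by (intro fun_space.span_scale fun_space.span_base)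
  then show ?thesis by (simp add: fun_scale_def)
qed

lemma gen_ring_span_monomials:
  fixes w :: "nat \<Rightarrow> 'a \<Rightarrow> 'k::field"
  assumes "g \<in> gen_ring (w ` {..<D})"
  shows "\<exists>e. g \<in> fun_space.span (monomials w D e)"
  using assms
proof induction
  case (const a)
  then show ?case using const_span_monomials by blast
next
  case (gen v)
  then obtain j where j: "j < D" "v = w j" by auto
  have "w j x = (\<Prod>i<D. w i x ^ (if i = j then 1 else 0))" for x
    using j(1) by (simp add: if_distrib[of "\<lambda>a. _ ^ a"] cong: if_cong)
  moreover have "(\<lambda>x. \<Prod>i<D. w i x ^ (if i = j then 1 else 0)) \<in> monomials w D 1"
    by (rule monomialsI) auto
  ultimately have "v \<in> monomials w D 1"
    unfolding j(2) by presburger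
  then show ?case using fun_space.span_base by blast
next
  case (add g h)
  then obtain e e' where "g \<in> fun_space.span (monomials w D e)" "h \<in> fun_space.span (monomials w D e')"
    by blast
  then have "g + h \<in> fun_space.span (monomials w D (max e e'))"
    by (intro fun_space.span_add) (auto intro: span_monomials_mono)
  then show ?case by (auto simp: plus_fun_def)
next
  case (mult g h)
  then show ?case using span_monomials_mult by blast
qed

lemma span_monomials_power:
  "g \<in> fun_space.span (monomials w D e) \<Longrightarrow> (\<lambda>x. g x ^ a) \<in> fun_space.span (monomials w D (a * e))"
proof (induction a)
  case 0
  then show ?case using const_span_monomials by simp
next
  case (Suc a)
  then show ?case using span_monomials_mult[of g w D e "\<lambda>x. g x ^ a" "a * e"] by simp
qed

lemma span_monomials_prod:
  fixes m :: nat
  assumes "\<And>i. i < m \<Longrightarrow> g i \<in> fun_space.span (monomials w D e)"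
  shows "(\<lambda>x. \<Prod>i<m. g i x) \<in> fun_space.span (monomials w D (m * e))"
  using assms
proof (induction m)
  case 0
  then show ?case using const_span_monomials by simp
next
  case (Suc m)
  then show ?case
    using span_monomials_mult[of "\<lambda>x. \<Prod>i<m. g i x" w D "m * e" "g m" e] by (simp add: algebra_simps)
qed

text \<open>Every polynomial has its exponents in some box \<open>{..<s}\<close> in each coordinate,
  and such a box has exactly \<open>s ^ m\<close> exponent vectors, the number needed for
  counting.\<close>

definition alg_independent :: "'a set \<Rightarrow> (nat \<Rightarrow> 'a \<Rightarrow> 'k::field) \<Rightarrow> nat \<Rightarrow> bool" where
  "alg_independent E f m \<longleftrightarrow> (\<forall>s c.
     (\<forall>x\<in>E. (\<Sum>\<alpha>\<in>(\<Pi>\<^sub>E i\<in>{..<m}. {..<s}). c \<alpha> * (\<Prod>i<m. f i x ^ \<alpha> i)) = 0) \<longrightarrow>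
     (\<forall>\<alpha>\<in>(\<Pi>\<^sub>E i\<in>{..<m}. {..<s::nat}). c \<alpha> = 0))"

lemma pow_bound_imp_le:
  fixes m D a :: nat
  assumes "\<And>s. s \<ge> 1 \<Longrightarrow> s ^ m \<le> Suc (s * a) ^ D"
  shows "m \<le> D"
proof (rule ccontr)
  assume "\<not> m \<le> D"
  \<comment> \<open>If \<open>m\<close> were larger than \<open>D\<close>, the bound would give
    \<open>s ^ Suc D\<close> at most \<open>(s * Suc a) ^ D\<close>, hence \<open>s\<close> at most
    \<open>Suc a ^ D\<close>, which this choice violates.\<close>
  define s where "s = Suc (Suc a ^ D)"
  have "s ^ D * s \<le> s ^ m"
    using power_increasing[of "Suc D" m s] \<open>\<not> m \<le> D\<close> by (simp add: s_def mult.commute)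
  also have "\<dots> \<le> Suc (s * a) ^ D"
    by (rule assms) (simp add: s_def)
  also have "\<dots> \<le> (s * Suc a) ^ D"
    by (rule power_mono) (auto simp: s_def)
  also have "\<dots> = s ^ D * Suc a ^ D"
    by (rule power_mult_distrib)
  finally show False
    by (simp add: s_def)
qed

text \<open>There are \<open>s ^ m\<close> independent monomials in the \<open>f i\<close> with exponents below \<open>s\<close>, in the span of
  the \<open>O(s ^ D)\<close> monomials of bounded degree in the \<open>w j\<close>.\<close>

lemma alg_independent_le:
  fixes w :: "nat \<Rightarrow> 'a \<Rightarrow> 'k::field"
  assumes ind: "alg_independent E f m" and f: "\<And>i. i < m \<Longrightarrow> f i \<in> gen_ring (w ` {..<D})"
  shows "m \<le> D"
proof -
  have "\<forall>i. \<exists>e. i < m \<longrightarrow> f i \<in> fun_space.span (monomials w D e)"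
    using gen_ring_span_monomials[OF f] by blast
  then obtain ee where ee: "\<And>i. i < m \<Longrightarrow> f i \<in> fun_space.span (monomials w D (ee i))"
    by metis
  \<comment> \<open>The sum is a common exponent bound for all \<open>f i\<close>; a product of
    \<open>m\<close> powers with exponents below \<open>s\<close> then needs exponents at most
    \<open>m * (s * e)\<close>.\<close>
  define e where "e = (\<Sum>i<m. ee i)"
  have fe: "f i \<in> fun_space.span (monomials w D e)" if "i < m" for i
    using ee[OF that] that by (auto simp: e_def intro!: member_le_sum elim!: span_monomials_mono)
  have "s ^ m \<le> Suc (s * (m * e)) ^ D" for s :: nat
  proof -
    let ?B = "\<Pi>\<^sub>E i\<in>{..<m}. {..<s}"
    define F where "F \<alpha> = (\<lambda>x. \<Prod>i<m. f i x ^ \<alpha> i)" for \<alpha>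
    have fin: "finite ?B" by (intro finite_PiE) auto
    have span: "F \<alpha> \<in> fun_space.span (monomials w D (m * (s * e)))" if "\<alpha> \<in> ?B" for \<alpha>
      unfolding F_def
    proof (rule span_monomials_prod)
      fix i assume "i < m"
      then have "\<alpha> i \<le> s" using that by (auto simp: PiE_iff intro: less_imp_le)
      then show "(\<lambda>x. f i x ^ \<alpha> i) \<in> fun_space.span (monomials w D (s * e))"
        by (intro span_monomials_mono[OF span_monomials_power[OF fe[OF \<open>i < m\<close>]]] mult_right_mono) auto
    qed
    \<comment> \<open>A combination that is zero as a function is in particular zero on
      \<open>E\<close>, where independence applies.\<close>
    have lin: "c \<alpha> = 0" if "(\<Sum>\<alpha>\<in>?B. fun_scale (c \<alpha>) (F \<alpha>)) = 0" "\<alpha> \<in> ?B" for c \<alpha>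
    proof -
      have "(\<Sum>\<alpha>\<in>?B. c \<alpha> * (\<Prod>i<m. f i x ^ \<alpha> i)) = 0" for x
      proof -
        have "(\<Sum>\<alpha>\<in>A. fun_scale (c \<alpha>) (F \<alpha>)) x = (\<Sum>\<alpha>\<in>A. c \<alpha> * (\<Prod>i<m. f i x ^ \<alpha> i))" for A
          by (induction A rule: infinite_finite_induct) (auto simp: fun_scale_def F_def)
        from this[of ?B] show ?thesis using that(1) by simp
      qed
      then show ?thesis
        using ind that(2) unfolding alg_independent_def by blast
    qed
    \<comment> \<open>Two exponent vectors with the same function would give a relation with
      coefficients 1 and -1. Injectivity ensures that there really are \<open>s ^ m\<close>
      functions.\<close>
    have inj: "inj_on F ?B"
    proof (rule inj_onI, rule ccontr)
      fix \<alpha> \<beta> assume *: "\<alpha> \<in> ?B" "\<beta> \<in> ?B" "F \<alpha> = F \<beta>" "\<alpha> \<noteq> \<beta>"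
      define c :: "_ \<Rightarrow> 'k" where "c \<gamma> = (if \<gamma> = \<alpha> then 1 else if \<gamma> = \<beta> then - 1 else 0)" for \<gamma>
      have "(\<Sum>\<gamma>\<in>?B. fun_scale (c \<gamma>) (F \<gamma>)) = (\<Sum>\<gamma>\<in>{\<alpha>, \<beta>}. fun_scale (c \<gamma>) (F \<gamma>))"
        using * fin by (intro sum.mono_neutral_right) (auto simp: c_def)
      also have "\<dots> = fun_scale 1 (F \<alpha>) + fun_scale (- 1) (F \<beta>)"
        using *(4) by (simp add: c_def)
      also have "\<dots> = 0"
        by (simp add: *(3) fun_scale_def fun_eq_iff)
      finally have "c \<alpha> = 0" using lin * by blast
      then show False by (simp add: c_def)
    qed
    have "fun_space.independent (F ` ?B)"
    proof (rule fun_space.independent_if_scalars_zero)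
      show "finite (F ` ?B)" using fin by simp
      fix c y assume "(\<Sum>y\<in>F ` ?B. fun_scale (c y) y) = 0" "y \<in> F ` ?B"
      then show "c y = 0"
        using lin[of "c \<circ> F"] by (auto simp: sum.reindex[OF inj])
    qed
    then have "card (F ` ?B) \<le> card (monomials w D (m * (s * e)))"
      using fun_space.independent_span_bound[OF finite_monomials] span by blast
    also have "\<dots> \<le> Suc (m * (s * e)) ^ D" by (rule card_monomials)
    finally show ?thesis
      by (simp add: card_image[OF inj] card_PiE mult_ac)
  qed
  then show ?thesis by (rule pow_bound_imp_le)
qed

lemma alg_independent_le_card:
  fixes W :: "('a \<Rightarrow> 'k::field) set"
  assumes ind: "alg_independent E f m" and f: "\<And>i. i < m \<Longrightarrow> f i \<in> gen_ring W" and W: "finite W"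
  shows "m \<le> card W"
proof -
  obtain w where "bij_betw w {0..<card W} W"
    using ex_bij_betw_nat_finite[OF W] by blast
  then have "W = w ` {..<card W}"
    by (simp add: bij_betw_def lessThan_atLeast0)
  then show ?thesis
    using alg_independent_le[OF ind, of w "card W"] f by simp
qed

lemma alg_independent_cong:
  "alg_independent E f m \<Longrightarrow> (\<And>i x. i < m \<Longrightarrow> x \<in> E \<Longrightarrow> f i x = g i x) \<Longrightarrow> alg_independent E g m"
  unfolding alg_independent_def by simp

text \<open>Splits off the exponent of the last function, so that a relation can be sorted by powers
  of it.\<close>

lemma sum_PiE_lessThan_Suc:
  "(\<Sum>\<alpha>\<in>(\<Pi>\<^sub>E i\<in>{..<Suc m}. S). h \<alpha>) = (\<Sum>a\<in>S. \<Sum>\<beta>\<in>(\<Pi>\<^sub>E i\<in>{..<m}. S). h (\<beta>(m := a)))"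
proof -
  have "(\<Pi>\<^sub>E i\<in>{..<Suc m}. S) = (\<lambda>(a, \<beta>). \<beta>(m := a)) ` (S \<times> (\<Pi>\<^sub>E i\<in>{..<m}. S))"
    unfolding lessThan_Suc by (rule PiE_insert_eq)
  moreover have "inj_on (\<lambda>(a, \<beta>). \<beta>(m := a)) (S \<times> (\<Pi>\<^sub>E i\<in>{..<m}. S))"
    using inj_combinator[of m "{..<m}" "\<lambda>_. S"] by simp
  ultimately show ?thesis
    by (simp add: sum.reindex sum.cartesian_product case_prod_unfold)
qed

text \<open>A strict chain of irreducible sets yields algebraically independent functions: if \<open>f\<close> vanishes
  on \<open>E m\<close> but not on \<open>E (m + 1)\<close>, the constant coefficient of a relation on \<open>E (m + 1)\<close> between
  powers of \<open>f\<close> vanishes on \<open>E m\<close>, so it is zero, and one factor of \<open>f\<close> can be cancelled.\<close>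

lemma alg_independent_chain:
  fixes E :: "nat \<Rightarrow> 'a set" and W :: "('a \<Rightarrow> 'k::field) set"
  assumes ne: "E 0 \<noteq> {}"
    and mono: "\<And>i. i < m \<Longrightarrow> E i \<subseteq> E (Suc i)"
    and prime: "\<And>i g h. i \<le> m \<Longrightarrow> g \<in> gen_ring W \<Longrightarrow> h \<in> gen_ring W \<Longrightarrow> (\<forall>x\<in>E i. g x * h x = 0) \<Longrightarrow>
        (\<forall>x\<in>E i. g x = 0) \<or> (\<forall>x\<in>E i. h x = 0)"
    and f: "\<And>i. i < m \<Longrightarrow> f i \<in> gen_ring W"
    and f0: "\<And>i x. i < m \<Longrightarrow> x \<in> E i \<Longrightarrow> f i x = 0"
    and f1: "\<And>i. i < m \<Longrightarrow> \<exists>x \<in> E (Suc i). f i x \<noteq> 0"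
  shows "alg_independent (E m) f m"
proof -
  have "alg_independent (E q) f q" if "q \<le> m" for q
    using that
  proof (induction q)
    case 0
    then show ?case using ne by (auto simp: alg_independent_def)
  next
    case (Suc q)
    then have q: "q < m" and IH: "alg_independent (E q) f q" by auto
    \<comment> \<open>The bound \<open>t\<close> on the powers of \<open>f q\<close> is separate
      from the bound \<open>s\<close> on the other exponents, because cancelling a factor
      \<open>f q\<close> lowers only \<open>t\<close>.\<close>
    have key: "\<forall>a<t. \<forall>\<beta>\<in>(\<Pi>\<^sub>E i\<in>{..<q}. {..<s}). c a \<beta> = 0"
      if "\<forall>x\<in>E (Suc q). (\<Sum>a<t. f q x ^ a * (\<Sum>\<beta>\<in>(\<Pi>\<^sub>E i\<in>{..<q}. {..<s}). c a \<beta> * (\<Prod>i<q. f i x ^ \<beta> i))) = 0"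
      for t s and c :: "nat \<Rightarrow> (nat \<Rightarrow> nat) \<Rightarrow> 'k"
      using that
    proof (induction t arbitrary: c)
      case 0
      then show ?case by simp
    next
      case (Suc t)
      let ?B = "\<Pi>\<^sub>E i\<in>{..<q}. {..<s}"
      define G where "G a x = (\<Sum>\<beta>\<in>?B. c a \<beta> * (\<Prod>i<q. f i x ^ \<beta> i))" for a x
      have G: "G a \<in> gen_ring W" for a
        unfolding G_def[abs_def] using q
        by (intro gen_ring_sum gen_ring.mult gen_ring.const gen_ring_prod gen_ring_power f) auto
      have rel: "G 0 x + f q x * (\<Sum>a<t. f q x ^ a * G (Suc a) x) = 0" if "x \<in> E (Suc q)" for x
        using Suc.prems that unfolding G_def[symmetric]
        by (simp add: sum.lessThan_Suc_shift sum_distrib_left mult.assoc del: sum.lessThan_Suc)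
      have "G 0 x = 0" if "x \<in> E q" for x
        using rel[of x] mono[OF q] f0[OF q that] that by auto
      then have c0: "\<forall>\<beta>\<in>?B. c 0 \<beta> = 0"
        using IH unfolding alg_independent_def G_def by blast
      then have "G 0 x = 0" for x by (simp add: G_def)
      then have "\<forall>x\<in>E (Suc q). f q x * (\<Sum>a<t. f q x ^ a * G (Suc a) x) = 0"
        using rel by simp
      moreover have "(\<lambda>x. \<Sum>a<t. f q x ^ a * G (Suc a) x) \<in> gen_ring W"
        using q by (intro gen_ring_sum gen_ring.mult gen_ring_power f G)
      ultimately have "\<forall>x\<in>E (Suc q). (\<Sum>a<t. f q x ^ a * G (Suc a) x) = 0"
        using prime[of "Suc q" "f q" "\<lambda>x. \<Sum>a<t. f q x ^ a * G (Suc a) x"] f[OF q] f1[OF q] q by auto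
      then have "\<forall>a<t. \<forall>\<beta>\<in>?B. c (Suc a) \<beta> = 0"
        unfolding G_def by (rule Suc.IH)
      then show ?case
        using c0 by (auto simp: less_Suc_eq_0_disj)
    qed
    show ?case
      unfolding alg_independent_def
    proof (intro allI impI)
      fix s :: nat and c :: "(nat \<Rightarrow> nat) \<Rightarrow> 'k"
      let ?B = "\<Pi>\<^sub>E i\<in>{..<q}. {..<s}"
      assume *: "\<forall>x\<in>E (Suc q). (\<Sum>\<alpha>\<in>(\<Pi>\<^sub>E i\<in>{..<Suc q}. {..<s}). c \<alpha> * (\<Prod>i<Suc q. f i x ^ \<alpha> i)) = 0"
      have "(\<Sum>\<alpha>\<in>(\<Pi>\<^sub>E i\<in>{..<Suc q}. {..<s}). c \<alpha> * (\<Prod>i<Suc q. f i x ^ \<alpha> i)) =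
          (\<Sum>a<s. f q x ^ a * (\<Sum>\<beta>\<in>?B. c (\<beta>(q := a)) * (\<Prod>i<q. f i x ^ \<beta> i)))" for x
      proof -
        have "(\<Prod>i<q. f i x ^ (\<beta>(q := a)) i) = (\<Prod>i<q. f i x ^ \<beta> i)" for \<beta> a
          by (rule prod.cong) auto
        then show ?thesis
          unfolding sum_PiE_lessThan_Suc by (simp add: sum_distrib_left mult_ac)
      qed
      then have zero: "\<forall>a<s. \<forall>\<beta>\<in>?B. c (\<beta>(q := a)) = 0"
        using key[where t = s and s = s and c = "\<lambda>a \<beta>. c (\<beta>(q := a))"] * by simp
      show "\<forall>\<alpha>\<in>(\<Pi>\<^sub>E i\<in>{..<Suc q}. {..<s}). c \<alpha> = 0"
        unfolding lessThan_Suc PiE_insert_eq using zero by auto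
    qed
  qed
  then show ?thesis by blast
qed

section \<open>Upper bound for the Krull dimension\<close>

definition chart_gens :: "nat \<Rightarrow> nat \<Rightarrow> nat \<Rightarrow> (nat \<Rightarrow> nat \<Rightarrow> 'k::field mpoly) \<Rightarrow> ((nat \<Rightarrow> 'k mpoly) set \<Rightarrow> 'k) set" where
  "chart_gens n r d b =
     (\<lambda>(k, i) K. quot_coords d b K (free_gen k) i) ` ({..<r} \<times> {..<d}) \<union>
     (\<lambda>(j, x) K. mult_matrix d b K j x) ` ({..<n} \<times> ({..<d} \<times> {..<d}))"

text \<open>Elements of the free module arise from the standard generators by linear combinations
  and multiplication by variables, and multiplying by \<open>var j\<close> applies the matrix of
  \<open>j\<close> to the coordinate vector. Finitely many generators therefore suffice.\<close>

lemma chart_ring_gens: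
  assumes "g \<in> chart_ring n r d b"
  shows "\<exists>h \<in> gen_ring (chart_gens n r d b). \<forall>K \<in> chart n r d b. g K = h K"
  using assms
proof induction
  case (const a)
  show ?case by (rule bexI[OF _ gen_ring.const[of a]]) simp
next
  case (coord f i)
  \<comment> \<open>All coordinates are treated at once, since multiplication by a variable mixes
    them.\<close>
  have "\<forall>i<d. \<exists>h \<in> gen_ring (chart_gens n r d b). \<forall>K \<in> chart n r d b. quot_coords d b K f i = h K"
    using coord(1)
  proof (induction rule: free_mod_induct)
    case (gen k)
    show ?case
    proof (intro allI impI)
      fix i assume "i < d"
      with gen have "(\<lambda>K. quot_coords d b K (free_gen k) i) \<in> gen_ring (chart_gens n r d b)"
        by (intro gen_ring.gen) (auto simp: chart_gens_def)
      then show "\<exists>h \<in> gen_ring (chart_gens n r d b). \<forall>K \<in> chart n r d b. quot_coords d b K (free_gen k) i = h K"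
        by (rule bexI[rotated]) simp
    qed
  next
    case (const f c)
    show ?case
    proof (intro allI impI)
      fix i assume "i < d"
      then obtain h where h: "h \<in> gen_ring (chart_gens n r d b)" "\<forall>K \<in> chart n r d b. quot_coords d b K f i = h K"
        using const by auto
      show "\<exists>h \<in> gen_ring (chart_gens n r d b). \<forall>K \<in> chart n r d b. quot_coords d b K (mscale (const c) f) i = h K"
      proof (intro bexI ballI)
        show "(\<lambda>K. c * h K) \<in> gen_ring (chart_gens n r d b)"
          by (intro gen_ring.mult gen_ring.const h)
        fix K assume "K \<in> chart n r d b"
        then show "quot_coords d b K (mscale (const c) f) i = c * h K"
          using h(2) const(1) by (simp add: quot_point.co_scale[OF chart_quot_point])
      qed
    qed
  next
    case (add f f')
    show ?case
    proof (intro allI impI)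
      fix i assume i: "i < d"
      then obtain h where h: "h \<in> gen_ring (chart_gens n r d b)" "\<forall>K \<in> chart n r d b. quot_coords d b K f i = h K"
        using add by auto
      obtain h' where h': "h' \<in> gen_ring (chart_gens n r d b)" "\<forall>K \<in> chart n r d b. quot_coords d b K f' i = h' K"
        using add i by auto
      show "\<exists>h \<in> gen_ring (chart_gens n r d b). \<forall>K \<in> chart n r d b. quot_coords d b K (f + f') i = h K"
      proof (intro bexI ballI)
        show "(\<lambda>K. h K + h' K) \<in> gen_ring (chart_gens n r d b)"
          by (intro gen_ring.add h h')
        fix K assume "K \<in> chart n r d b"
        then show "quot_coords d b K (f + f') i = h K + h' K"
          using h(2) h'(2) add.hyps by (simp add: quot_point.co_add[OF chart_quot_point])
      qed
    qed
  next
    case (var f j)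
    then obtain h where h: "\<And>k. k < d \<Longrightarrow> h k \<in> gen_ring (chart_gens n r d b)"
      "\<And>k K. k < d \<Longrightarrow> K \<in> chart n r d b \<Longrightarrow> quot_coords d b K f k = h k K"
      by metis
    show ?case
    proof (intro allI impI)
      fix i assume i: "i < d"
      show "\<exists>h \<in> gen_ring (chart_gens n r d b). \<forall>K \<in> chart n r d b. quot_coords d b K (mscale (var j) f) i = h K"
      proof (intro bexI ballI)
        have "(\<lambda>K. mult_matrix d b K j (i, k)) \<in> gen_ring (chart_gens n r d b)" if "k < d" for k
          using that i var.hyps by (intro gen_ring.gen) (force simp: chart_gens_def)
        then show "(\<lambda>K. \<Sum>k<d. h k K * mult_matrix d b K j (i, k)) \<in> gen_ring (chart_gens n r d b)"
          by (intro gen_ring_sum gen_ring.mult h) auto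
        fix K assume "K \<in> chart n r d b"
        then show "quot_coords d b K (mscale (var j) f) i = (\<Sum>k<d. h k K * mult_matrix d b K j (i, k))"
          using h(2) var.hyps i by (simp add: quot_point.co_var[OF chart_quot_point])
      qed
    qed
  next
    case zero
    show ?case
    proof (intro allI impI)
      fix i
      show "\<exists>h \<in> gen_ring (chart_gens n r d b). \<forall>K \<in> chart n r d b. quot_coords d b K 0 i = h K"
        by (rule bexI[OF _ gen_ring.const[of 0]]) (simp add: quot_point.co_0[OF chart_quot_point])
    qed
  qed
  then show ?case using coord(2) by blast
next
  case (add g g')
  then obtain h h' where
    "h \<in> gen_ring (chart_gens n r d b)" "\<forall>K \<in> chart n r d b. g K = h K"
    "h' \<in> gen_ring (chart_gens n r d b)" "\<forall>K \<in> chart n r d b. g' K = h' K"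
    by auto
  then show ?case
    by (intro bexI[of _ "\<lambda>K. h K + h' K"] gen_ring.add) auto
next
  case (mult g g')
  then obtain h h' where
    "h \<in> gen_ring (chart_gens n r d b)" "\<forall>K \<in> chart n r d b. g K = h K"
    "h' \<in> gen_ring (chart_gens n r d b)" "\<forall>K \<in> chart n r d b. g' K = h' K"
    by auto
  then show ?case
    by (intro bexI[of _ "\<lambda>K. h K * h' K"] gen_ring.mult) auto
qed

lemma gen_ring_agree:
  assumes "g \<in> gen_ring V" and V: "\<And>v. v \<in> V \<Longrightarrow> \<exists>h \<in> gen_ring W. \<forall>x\<in>E. v x = h x"
  shows "\<exists>h \<in> gen_ring W. \<forall>x\<in>E. g x = h x"
  using assms(1)
proof induction
  case (const a)
  show ?case by (rule bexI[OF _ gen_ring.const[of a]]) simp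
next
  case (gen v)
  then show ?case by (rule V)
next
  case (add g g')
  then obtain h h' where
    "h \<in> gen_ring W" "\<forall>K \<in> E. g K = h K" "h' \<in> gen_ring W" "\<forall>K \<in> E. g' K = h' K"
    by auto
  then show ?case
    by (intro bexI[of _ "\<lambda>K. h K + h' K"] gen_ring.add) auto
next
  case (mult g g')
  then obtain h h' where
    "h \<in> gen_ring W" "\<forall>K \<in> E. g K = h K" "h' \<in> gen_ring W" "\<forall>K \<in> E. g' K = h' K"
    by auto
  then show ?case
    by (intro bexI[of _ "\<lambda>K. h K * h' K"] gen_ring.mult) auto
qed

lemma mat_scale_eq: "mat_scale = fun_scale"
  by (simp add: mat_scale_def fun_scale_def fun_eq_iff)

definition mult_rank :: "nat \<Rightarrow> nat \<Rightarrow> (nat \<Rightarrow> nat \<Rightarrow> 'k::field mpoly) \<Rightarrow> (nat \<Rightarrow> 'k mpoly) set \<Rightarrow> nat" where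
  "mult_rank n d b K = vector_space.dim mat_scale (module.span mat_scale (mult_matrix d b K ` {..<n}))"

lemma mult_rank_eq_dim: "mult_rank n d b K = fun_space.dim (mult_matrix d b K ` {..<n})"
  by (simp add: mult_rank_def mat_scale_eq)

text \<open>Coordinates with respect to a basis of the span. Padding the basis by zeros to
  \<open>l\<close> vectors makes the number of parameters the same at every point.\<close>

lemma mult_matrix_factorization:
  assumes "mult_rank n d b K \<le> l"
  shows "\<exists>P Q. \<forall>j<n. \<forall>x. mult_matrix d b K j x = (\<Sum>k<l. P j k * Q k x)"
proof -
  let ?V = "mult_matrix d b K ` {..<n}"
  obtain B where B: "B \<subseteq> ?V" "fun_space.independent B" "?V \<subseteq> fun_space.span B" "card B = fun_space.dim ?V"
    using fun_space.basis_exists by blast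
  then have fin: "finite B" by (meson finite_imageI finite_lessThan finite_subset)
  have card: "card B \<le> l" using assms B(4) by (simp add: mult_rank_eq_dim)
  obtain q where q: "bij_betw q {0..<card B} B"
    using ex_bij_betw_nat_finite[OF fin] by blast
  have "\<exists>p. \<forall>x. mult_matrix d b K j x = (\<Sum>k<l. p k * (if k < card B then q k x else 0))" if "j < n" for j
  proof -
    have "mult_matrix d b K j \<in> fun_space.span B" using B(3) that by auto
    then obtain u where u: "mult_matrix d b K j = (\<Sum>v\<in>B. fun_scale (u v) v)"
      using fun_space.span_finite[OF fin] by auto
    have "mult_matrix d b K j x = (\<Sum>k<l. u (q k) * (if k < card B then q k x else 0))" for x
    proof -
      have "mult_matrix d b K j x = (\<Sum>v\<in>B. u v * v x)"
        by (simp add: u sum_fun_apply fun_scale_def)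
      also have "\<dots> = (\<Sum>k\<in>{0..<card B}. u (q k) * q k x)"
        by (rule sum.reindex_bij_betw[OF q, symmetric])
      also have "\<dots> = (\<Sum>k<l. u (q k) * (if k < card B then q k x else 0))"
        using card by (intro sum.mono_neutral_cong_left) auto
      finally show ?thesis .
    qed
    then show ?thesis by (intro exI[of _ "\<lambda>k. u (q k)"]) blast
  qed
  then obtain P where "\<And>j x. j < n \<Longrightarrow> mult_matrix d b K j x = (\<Sum>k<l. P j k * (if k < card B then q k x else 0))"
    by metis
  then show ?thesis
    by (intro exI[of _ P] exI[of _ "\<lambda>k x. if k < card B then q k x else 0"]) simp
qed

text \<open>The zero locus of a regular function, with the complement of the chart added, is closed.
  Two such sets cover \<open>S\<close>, so irreducibility of \<open>S\<close> becomes primality of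
  its vanishing ideal on the chart.\<close>

lemma irreducible_prime:
  assumes irr: "irreducible_in (subtopology (Quot n r d) Y) S"
    and g: "g \<in> chart_ring n r d b" and h: "h \<in> chart_ring n r d b"
    and gh: "\<forall>K \<in> S \<inter> chart n r d b. g K * h K = (0 :: 'k::field)"
  shows "(\<forall>K \<in> S \<inter> chart n r d b. g K = 0) \<or> (\<forall>K \<in> S \<inter> chart n r d b. h K = 0)"
proof -
  let ?T = "subtopology (Quot n r d) Y"
  let ?A = "\<lambda>g. topspace ?T - {K \<in> chart n r d b. g K \<noteq> 0}"
  have closed: "closedin ?T (?A g)" if "g \<in> chart_ring n r d b" for g
  proof -
    have "openin ?T (Y \<inter> {K \<in> chart n r d b. g K \<noteq> 0})"
      using openin_chart_nonzero[OF that] by (rule openin_subtopology_Int2)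
    then have "closedin ?T (topspace ?T - (Y \<inter> {K \<in> chart n r d b. g K \<noteq> 0}))"
      by (rule closedin_diff[OF closedin_topspace])
    also have "topspace ?T - (Y \<inter> {K \<in> chart n r d b. g K \<noteq> 0}) = ?A g"
      by auto
    finally show ?thesis .
  qed
  have "S \<subseteq> ?A g \<union> ?A h"
    using irr gh unfolding irreducible_in_def by auto
  then have "S \<subseteq> ?A g \<or> S \<subseteq> ?A h"
    using irr closed[OF g] closed[OF h] unfolding irreducible_in_def by blast
  then show ?thesis by auto
qed

lemma gen_ring_chart_ring: "g \<in> gen_ring (chart_ring n r d b) \<Longrightarrow> g \<in> chart_ring n r d b"
  by (induction rule: gen_ring.induct) (auto intro: chart_ring.intros)

text \<open>The rank is bounded for every basis at a point because the chart is chosen only after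
  the chain is given.\<close>

lemma krull_dim_le:
  fixes Y :: "(nat \<Rightarrow> 'k::field mpoly) set set"
  assumes rank: "\<And>K b. K \<in> Y \<Longrightarrow> K \<in> chart n r d b \<Longrightarrow> mult_rank n d b K \<le> l"
  shows "krull_dim (subtopology (Quot n r d) Y) \<le> ereal (real (n * l + l * d ^ 2 + r * d))"
  unfolding krull_dim_def
proof (rule Sup_least, safe)
  let ?T = "subtopology (Quot n r d) Y"
  fix m and C :: "nat \<Rightarrow> (nat \<Rightarrow> 'k mpoly) set set"
  assume C: "\<forall>i\<le>m. closedin ?T (C i) \<and> irreducible_in ?T (C i)" and strict: "\<forall>i<m. C i \<subset> C (Suc i)"
  have "C 0 \<noteq> {}" using C by (auto simp: irreducible_in_def)
  \<comment> \<open>A point of the smallest member lies in all members, so one chart around it meets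
    the whole chain.\<close>
  then obtain K0 where K0: "K0 \<in> C 0" by blast
  have CY: "C i \<subseteq> Y" and Cq: "C i \<subseteq> quot_points n r d" if "i \<le> m" for i
    using C that by (auto simp: irreducible_in_def topspace_Quot)
  then obtain b where b: "K0 \<in> chart n r d b"
    using K0 by (fastforce simp: chart_def quot_points_def)
  have K0C: "K0 \<in> C i" if "i \<le> m" for i
    using that by (induction i) (use K0 strict in \<open>auto simp: Suc_le_eq\<close>)
  define E where "E i = C i \<inter> chart n r d b" for i
  have ex_f: "\<exists>f \<in> chart_ring n r d b. (\<forall>K \<in> E i. f K = 0) \<and> (\<exists>K \<in> E (Suc i). f K \<noteq> 0)" if i: "i < m" for i
  proof -
    \<comment> \<open>Otherwise \<open>C i\<close> and the complement of the chart would cover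
      \<open>C (Suc i)\<close>. By irreducibility one of them would contain it; strictness excludes
      the first and \<open>K0\<close> the second.\<close>
    have "\<exists>K \<in> E (Suc i). K \<notin> C i"
    proof (rule ccontr)
      assume no: "\<not> ?thesis"
      have "openin ?T (Y \<inter> chart n r d b)"
        using openin_chart by (rule openin_subtopology_Int2)
      then have cl: "closedin ?T (topspace ?T - (Y \<inter> chart n r d b))"
        by (rule closedin_diff[OF closedin_topspace])
      have irr: "irreducible_in ?T (C (Suc i))" and "closedin ?T (C i)"
        using C i by auto
      moreover have "C (Suc i) \<subseteq> C i \<union> (topspace ?T - (Y \<inter> chart n r d b))"
        using no irr unfolding irreducible_in_def E_def by blast
      ultimately have "C (Suc i) \<subseteq> C i \<or> C (Suc i) \<subseteq> topspace ?T - (Y \<inter> chart n r d b)"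
        using cl unfolding irreducible_in_def by blast
      then show False
        using strict i K0C[of "Suc i"] b CY[of "Suc i"] by auto
    qed
    then obtain K where K: "K \<in> E (Suc i)" "K \<notin> C i" by blast
    have "closedin ?T (C i)" using C i by simp
    then obtain A where A: "closedin (Quot n r d) A" "C i = A \<inter> Y"
      by (auto simp: closedin_subtopology)
    have "K \<notin> A" "K \<in> chart n r d b"
      using K A CY[of "Suc i"] i by (auto simp: E_def)
    then show ?thesis
      using Quot_closed_separate[OF A(1), of K b] K A(2) by (fastforce simp: E_def)
  qed
  then obtain f where f: "\<And>i. i < m \<Longrightarrow> f i \<in> chart_ring n r d b"
    "\<And>i K. i < m \<Longrightarrow> K \<in> E i \<Longrightarrow> f i K = 0" "\<And>i. i < m \<Longrightarrow> \<exists>K \<in> E (Suc i). f i K \<noteq> 0"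
    by metis
  have ind: "alg_independent (E m) f m"
  proof (rule alg_independent_chain[where W = "chart_ring n r d b"])
    show "E 0 \<noteq> {}" using K0 b by (auto simp: E_def)
    show "E i \<subseteq> E (Suc i)" if "i < m" for i
      using strict that by (auto simp: E_def)
    show "f i \<in> gen_ring (chart_ring n r d b)" if "i < m" for i
      using f(1)[OF that] by (rule gen_ring.gen)
    show "(\<forall>K \<in> E i. g K = 0) \<or> (\<forall>K \<in> E i. h K = 0)"
      if "i \<le> m" "g \<in> gen_ring (chart_ring n r d b)" "h \<in> gen_ring (chart_ring n r d b)"
        "\<forall>K \<in> E i. g K * h K = 0" for i g h
      using irreducible_prime[of n r d Y "C i", OF _ gen_ring_chart_ring[OF that(2)] gen_ring_chart_ring[OF that(3)]]
        C that(1,4) unfolding E_def by blast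
  qed (use f in auto)
  \<comment> \<open>The factorizations at different points are chosen independently of each other;
    they become generators as mere functions of \<open>K\<close>.\<close>
  have "\<forall>K. \<exists>P Q. K \<in> Y \<inter> chart n r d b \<longrightarrow> (\<forall>j<n. \<forall>x. mult_matrix d b K j x = (\<Sum>k<l. P j k * Q k x))"
    using mult_matrix_factorization rank by blast
  then obtain P Q where PQ: "\<And>K j x. K \<in> Y \<inter> chart n r d b \<Longrightarrow> j < n \<Longrightarrow>
      mult_matrix d b K j x = (\<Sum>k<l. P K j k * Q K k x)"
    by metis
  \<comment> \<open>\<open>W1\<close> holds the coefficients of the \<open>n\<close> variables,
    \<open>W2\<close> the entries of the \<open>l\<close> spanning matrices, and \<open>W3\<close>
    the coordinates of the \<open>r\<close> generators; these are the three summands of the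
    bound.\<close>
  define W1 where "W1 = (\<lambda>(j, k) K. P K j k) ` ({..<n} \<times> {..<l})"
  define W2 where "W2 = (\<lambda>(k, x) K. Q K k x) ` ({..<l} \<times> ({..<d} \<times> {..<d}))"
  define W3 where "W3 = (\<lambda>(k, i) K. quot_coords d b K (free_gen k) i) ` ({..<r} \<times> {..<d})"
  define W where "W = W1 \<union> W2 \<union> W3"
  have fin: "finite W1" "finite W2" "finite W3" by (auto simp: W1_def W2_def W3_def)
  have "card W1 \<le> n * l" "card W2 \<le> l * d ^ 2" "card W3 \<le> r * d"
    unfolding W1_def W2_def W3_def
    by (rule order_trans[OF card_image_le]; simp add: card_cartesian_product power2_eq_square)+
  moreover have "card W \<le> card W1 + card W2 + card W3"
    unfolding W_def by (meson add_right_mono card_Un_le order_trans)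
  ultimately have card: "card W \<le> n * l + l * d ^ 2 + r * d" by linarith
  have gens: "\<exists>h \<in> gen_ring W. \<forall>K \<in> Y \<inter> chart n r d b. v K = h K" if "v \<in> chart_gens n r d b" for v
    using that unfolding chart_gens_def
  proof (elim UnE imageE)
    fix p assume v: "v = (case p of (k, i) \<Rightarrow> \<lambda>K. quot_coords d b K (free_gen k) i)" "p \<in> {..<r} \<times> {..<d}"
    then have "v \<in> W" by (auto simp: W_def W3_def)
    then show ?thesis by (intro bexI[OF _ gen_ring.gen]) auto
  next
    fix p assume v: "v = (case p of (j, x) \<Rightarrow> \<lambda>K. mult_matrix d b K j x)" "p \<in> {..<n} \<times> ({..<d} \<times> {..<d})"
    obtain j x where p: "p = (j, x)" "j < n" "x \<in> {..<d} \<times> {..<d}"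
      using v(2) by auto
    have "(\<lambda>K. P K j k) \<in> W" if "k < l" for k
      unfolding W_def W1_def using that p by (auto intro: image_eqI[of _ _ "(j, k)"])
    moreover have "(\<lambda>K. Q K k x) \<in> W" if "k < l" for k
      unfolding W_def W2_def using that p by (auto intro: image_eqI[of _ _ "(k, x)"])
    ultimately have "(\<lambda>K. \<Sum>k<l. P K j k * Q K k x) \<in> gen_ring W"
      by (intro gen_ring_sum gen_ring.mult gen_ring.gen) auto
    then show ?thesis
      using PQ p(2) by (intro bexI[of _ "\<lambda>K. \<Sum>k<l. P K j k * Q K k x"]) (auto simp: v(1) p(1))
  qed
  have "\<exists>h \<in> gen_ring W. \<forall>K \<in> Y \<inter> chart n r d b. f i K = h K" if i: "i < m" for i
  proof -
    obtain h where h: "h \<in> gen_ring (chart_gens n r d b)" "\<forall>K \<in> chart n r d b. f i K = h K"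
      using chart_ring_gens[OF f(1)[OF i]] by blast
    obtain h' where "h' \<in> gen_ring W" "\<forall>K \<in> Y \<inter> chart n r d b. h K = h' K"
      using gen_ring_agree[OF h(1) gens] by blast
    then show ?thesis using h(2) by auto
  qed
  then obtain h where h: "\<And>i. i < m \<Longrightarrow> h i \<in> gen_ring W"
    "\<And>i K. i < m \<Longrightarrow> K \<in> Y \<inter> chart n r d b \<Longrightarrow> f i K = h i K"
    by metis
  have "alg_independent (E m) h m"
    using ind by (rule alg_independent_cong) (use h(2) CY[of m] in \<open>auto simp: E_def\<close>)
  then have "m \<le> card W"
    by (rule alg_independent_le_card) (use h fin in \<open>auto simp: W_def\<close>)
  then have "m \<le> n * l + l * d ^ 2 + r * d" using card by linarith
  then show "ereal (real m) \<le> ereal (real (n * l + l * d ^ 2 + r * d))"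
    by (simp only: ereal_less_eq of_nat_le_iff)
qed

section \<open>Families of points over affine spaces\<close>

interpretation const_hom: coeff_hom "const :: 'k::comm_ring_1 \<Rightarrow> 'k mpoly"
  by unfold_locales auto

lemma eval_in_polys:
  assumes "p \<in> polys n" and "\<And>j. j < n \<Longrightarrow> s j \<in> polys n"
  shows "mpoly_eval const s p \<in> polys n"
  using assms(1) by (induction rule: polys_induct) (auto simp: assms(2) polys_add polys_mult)

definition mod_subst :: "(nat \<Rightarrow> 'k::comm_ring_1 mpoly) \<Rightarrow> (nat \<Rightarrow> 'k mpoly) \<Rightarrow> nat \<Rightarrow> 'k mpoly" where
  "mod_subst s f = (\<lambda>k. mpoly_eval const s (f k))"

lemma mod_subst_simps [simp]:
  "mod_subst s (f + g) = mod_subst s f + mod_subst s g"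
  "mod_subst s (f - g) = mod_subst s f - mod_subst s g"
  "mod_subst s 0 = 0"
  "mod_subst s (mscale p f) = mscale (mpoly_eval const s p) (mod_subst s f)"
  "mod_subst s (free_gen k) = free_gen k"
  by (auto simp: mod_subst_def mscale_def free_gen_def fun_eq_iff)

lemma mod_subst_lincomb: "mod_subst s (lincomb d a b) = lincomb d a (\<lambda>k. mod_subst s (b k))"
proof -
  have "mod_subst s (sum f A) = (\<Sum>i\<in>A. mod_subst s (f i))" for f and A :: "nat set"
  proof (induction A rule: infinite_finite_induct)
    case (insert i A)
    then show ?case unfolding sum.insert[OF insert(1,2)] by (simp only: mod_subst_simps)
  qed (simp_all only: sum.infinite sum.empty mod_subst_simps not_False_eq_True)
  then show ?thesis by (simp add: lincomb_def)
qed

lemma mod_subst_in_free_mod: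
  "f \<in> free_mod n r \<Longrightarrow> (\<And>j. j < n \<Longrightarrow> s j \<in> polys n) \<Longrightarrow> mod_subst s f \<in> free_mod n r"
  by (auto simp: free_mod_def mod_subst_def eval_in_polys)

lemma (in quot_point) co_linear_form:
  assumes "J \<subseteq> {..<n}" "f \<in> free_mod n r"
  shows "co (mscale (\<Sum>j\<in>J. const (a j) * var j) f) i = (\<Sum>j\<in>J. a j * co (mscale (var j) f) i)"
proof -
  have eq: "mscale (\<Sum>j\<in>J. const (a j) * var j) f = (\<Sum>j\<in>J. mscale (const (a j)) (mscale (var j) f))"
    by (simp add: mscale_def fun_eq_iff sum_fun_apply sum_distrib_right mult.assoc)
  have "co (mscale (\<Sum>j\<in>J. const (a j) * var j) f) = (\<lambda>i. \<Sum>j\<in>J. a j * co (mscale (var j) f) i)"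
    unfolding eq using assms by (subst co_sum) (auto simp: co_scale free_mod_mscale subset_iff simp del: mscale_simps)
  then show ?thesis by simp
qed

text \<open>A basis and its coordinates depend only on classes modulo \<open>K\<close>, so
  representatives of a more convenient shape may be used.\<close>

lemma (in quot_point) quot_point_replace:
  assumes b': "\<And>k. k < d \<Longrightarrow> b' k \<in> free_mod n r" "\<And>k. k < d \<Longrightarrow> b' k - b k \<in> K"
  shows "quot_point n r d b' K" and "f \<in> free_mod n r \<Longrightarrow> quot_coords d b' K f = co f"
proof -
  have "lincomb d c b' - lincomb d c b \<in> K" for c
  proof -
    have "lincomb d c b' - lincomb d c b = lincomb d c (\<lambda>k. b' k - b k)"
      by (simp add: lincomb_def sum_subtractf)
    also have "\<dots> \<in> K"
      unfolding lincomb_def using b' by (intro K_sum K_mscale) auto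
    finally show ?thesis .
  qed
  then have iff: "f - lincomb d c b' \<in> K \<longleftrightarrow> f - lincomb d c b \<in> K" for f c
    using K_add[of "f - lincomb d c b'" "lincomb d c b' - lincomb d c b"]
      K_diff[of "f - lincomb d c b" "lincomb d c b' - lincomb d c b"] by auto
  have "quot_basis n r d b' K"
    using basis b' unfolding quot_basis_def lincomb_def[symmetric] iff by simp
  then show "quot_point n r d b' K"
    using submod by unfold_locales
  show "quot_coords d b' K f = co f" if "f \<in> free_mod n r"
    unfolding quot_coords_def lincomb_def[symmetric] iff by simp
qed

section \<open>The linear family through a given point\<close>

text \<open>The variables in \<open>J\<close> act by matrices spanning all the others. The
  coefficients \<open>c\<close> have the type of a parameter of the family, so that the given
  relations can themselves be substituted.\<close>

locale deformation = quot_point n r d b K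
  for n r d and b :: "nat \<Rightarrow> nat \<Rightarrow> 'k::field_char_0 mpoly" and K +
  fixes J :: "nat set" and c :: "nat \<times> nat \<Rightarrow> 'k"
  assumes J: "J \<subseteq> {..<n}"
    and lin: "\<And>i x. i < n \<Longrightarrow> mult_matrix d b K i x = (\<Sum>j\<in>J. c (i, j) * mult_matrix d b K j x)"
begin

lemma finite_J: "finite J"
  using J finite_subset by blast

definition lin_subst :: "(nat \<times> nat \<Rightarrow> 'k) \<Rightarrow> nat \<Rightarrow> 'k mpoly" where
  "lin_subst t i = (if i \<in> J then var i else \<Sum>j\<in>J. const (t (i, j)) * var j)"

lemma lin_subst_polys: "i < n \<Longrightarrow> lin_subst t i \<in> polys n"
  using J by (auto simp: lin_subst_def intro!: polys_sum polys_mult)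

abbreviation "sub t \<equiv> mod_subst (lin_subst t)"

lemma sub_in: "f \<in> free_mod n r \<Longrightarrow> sub t f \<in> free_mod n r"
  by (rule mod_subst_in_free_mod[OF _ lin_subst_polys])

text \<open>After one substitution only variables from \<open>J\<close> occur, and every
  \<open>lin_subst t\<close> fixes these.\<close>

lemma eval_lin_subst_idem:
  assumes "p \<in> polys n"
  shows "mpoly_eval const (lin_subst t) (mpoly_eval const (lin_subst u) p) = mpoly_eval const (lin_subst u) p"
  using assms
proof (induction rule: polys_induct)
  case (var p j)
  have sum: "mpoly_eval const (lin_subst t) (\<Sum>j\<in>A. const (u (i, j)) * var j) = (\<Sum>j\<in>A. const (u (i, j)) * var j)"
    if "A \<subseteq> J" for A i
    using that by (induction A rule: infinite_finite_induct) (auto simp: lin_subst_def)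
  have "mpoly_eval const (lin_subst t) (lin_subst u j) = lin_subst u j"
    using sum[OF order_refl, of j] by (cases "j \<in> J") (auto simp: lin_subst_def)
  then show ?case using var by simp
qed auto

lemma sub_idem: "f \<in> free_mod n r \<Longrightarrow> sub t (sub u f) = sub u f"
  unfolding mod_subst_def
proof
  fix k assume "f \<in> free_mod n r"
  then have "f k \<in> polys n" by (cases "k < r") (auto simp: free_mod_def)
  then show "mpoly_eval const (lin_subst t) (mpoly_eval const (lin_subst u) (f k)) = mpoly_eval const (lin_subst u) (f k)"
    by (rule eval_lin_subst_idem)
qed

text \<open>By \<open>lin\<close>, the variable \<open>i\<close> and its linear form act by the same
  matrix, so their difference annihilates the quotient.\<close>

lemma lin_subst_c_diff:
  assumes i: "i < n" and f: "f \<in> free_mod n r"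
  shows "mscale (lin_subst c i - var i) f \<in> K"
proof (cases "i \<in> J")
  case True
  then show ?thesis by (simp add: lin_subst_def)
next
  case False
  have p: "lin_subst c i - var i \<in> polys n"
    using polys_add[OF lin_subst_polys polys_uminus[OF var_in_polys], of i i] i by simp
  have zero: "co (mscale (lin_subst c i - var i) (b k)) x = 0" if k: "k < d" for k x
  proof -
    have bk: "b k \<in> free_mod n r" using k by (rule basis_in)
    show ?thesis
    proof (cases "x < d")
      case True
      have "co (mscale (lin_subst c i) (b k)) x = co (mscale (var i) (b k)) x"
        using lin[OF i, of "(x, k)"] False True k J bk by (simp add: lin_subst_def co_linear_form mult_matrix_def)
      then show ?thesis
        using i bk by (simp add: co_diff free_mod_mscale lin_subst_polys)
    next
      case False
      then show ?thesis using p bk by (intro co_ge free_mod_mscale) auto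
    qed
  qed
  have "co (mscale (lin_subst c i - var i) f) = (\<lambda>x. 0)"
    using co_mscale[OF p f] zero by (intro ext) simp
  then show ?thesis
    using co_eq_0_iff free_mod_mscale[OF p f] by blast
qed

text \<open>Substituting with \<open>c\<close> induces the identity on the quotient by
  \<open>K\<close>. Hence it does not change the class of a basis element, and the family
  constructed from \<open>K\<close> passes through \<open>K\<close> at \<open>c\<close>.\<close>

lemma sub_c_diff:
  assumes "f \<in> free_mod n r"
  shows "sub c f - f \<in> K"
  using assms
proof (induction rule: free_mod_induct)
  case (const f a)
  have "mscale (const a) (sub c f - f) \<in> K" by (intro K_mscale const_in_polys const.IH)
  also have "mscale (const a) (sub c f - f) = sub c (mscale (const a) f) - mscale (const a) f"
    by simp
  finally show ?case .
next
  case (add f g)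
  then have "(sub c f - f) + (sub c g - g) \<in> K" by (intro K_add)
  also have "(sub c f - f) + (sub c g - g) = sub c (f + g) - (f + g)" by simp
  finally show ?case .
next
  case (var f j)
  then have "mscale (lin_subst c j) (sub c f - f) + mscale (lin_subst c j - var j) f \<in> K"
    by (intro K_add K_mscale lin_subst_polys lin_subst_c_diff)
  also have "mscale (lin_subst c j) (sub c f - f) + mscale (lin_subst c j - var j) f =
      sub c (mscale (var j) f) - mscale (var j) f"
    by simp
  finally show ?case .
next
  case (gen k)
  show ?case unfolding mod_subst_simps diff_self by (rule K_0)
next
  case zero
  show ?case unfolding mod_subst_simps diff_self by (rule K_0)
qed

text \<open>The same classes as \<open>b\<close>, but represented in the variables of
  \<open>J\<close> alone and hence fixed by every substitution. This puts the whole family into a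
  single chart.\<close>

definition b' :: "nat \<Rightarrow> nat \<Rightarrow> 'k mpoly" where
  "b' k = sub c (b k)"

lemma b'_in: "k < d \<Longrightarrow> b' k \<in> free_mod n r"
  by (simp add: b'_def sub_in basis_in)

lemma sub_b': "k < d \<Longrightarrow> sub t (b' k) = b' k"
  by (simp add: b'_def sub_idem basis_in)

lemma b'_diff: "k < d \<Longrightarrow> b' k - b k \<in> K"
  by (simp add: b'_def sub_c_diff basis_in)

lemma quot_point_b': "quot_point n r d b' K"
  by (rule quot_point_replace(1)[OF b'_in b'_diff])

lemma coords_b': "f \<in> free_mod n r \<Longrightarrow> quot_coords d b' K f = co f"
  by (rule quot_point_replace(2)[OF b'_in b'_diff])

lemma sub_lincomb_b': "sub t (lincomb d a b') = lincomb d a b'"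
  unfolding mod_subst_lincomb by (simp add: lincomb_def sub_b')

text \<open>A preimage of \<open>K\<close> under a substitution of variables is automatically a
  submodule, so commutation of the new multiplication matrices never has to be checked.\<close>

definition family :: "(nat \<times> nat \<Rightarrow> 'k) \<Rightarrow> (nat \<Rightarrow> 'k mpoly) set" where
  "family t = {f \<in> free_mod n r. sub t f \<in> K}"

lemma family_diff_iff:
  "f \<in> free_mod n r \<Longrightarrow> f - lincomb d a b' \<in> family t \<longleftrightarrow> sub t f - lincomb d a b' \<in> K"
  by (simp add: family_def free_mod_diff lincomb_in_free_mod b'_in sub_lincomb_b')

text \<open>As \<open>sub t\<close> fixes combinations of \<open>b'\<close>, coordinates of
  \<open>f\<close> modulo \<open>family t\<close> are the same as coordinates of
  \<open>sub t f\<close> modulo \<open>K\<close>.\<close>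

lemma quot_point_family: "quot_point n r d b' (family t)"
proof
  interpret b': quot_point n r d b' K by (rule quot_point_b')
  show "is_submod n r (family t)"
    by (auto simp: is_submod_def family_def free_mod_add free_mod_mscale
        intro!: K_add K_mscale eval_in_polys lin_subst_polys)
  show "quot_basis n r d b' (family t)"
    unfolding quot_basis_def lincomb_def[symmetric]
  proof (intro conjI allI impI ballI)
    fix f :: "nat \<Rightarrow> 'k mpoly" assume f: "f \<in> free_mod n r"
    show "\<exists>!a. (\<forall>i\<ge>d. a i = 0) \<and> f - lincomb d a b' \<in> family t"
      unfolding family_diff_iff[OF f] by (rule b'.co_ex1[OF sub_in[OF f]])
  qed (rule b'_in)
qed

lemma family_in_chart: "family t \<in> chart n r d b'"
  by (rule quot_point_chart[OF quot_point_family])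

lemma coords_family: "f \<in> free_mod n r \<Longrightarrow> quot_coords d b' (family t) f = co (sub t f)"
proof -
  assume f: "f \<in> free_mod n r"
  then have "quot_coords d b' (family t) f = quot_coords d b' K (sub t f)"
    unfolding quot_coords_def lincomb_def[symmetric] by (simp add: family_diff_iff)
  then show ?thesis using f by (simp add: coords_b' sub_in)
qed

text \<open>The variables outside \<open>J\<close> act by freely prescribed combinations of the
  fixed matrices from \<open>J\<close>. Dependence on \<open>t\<close> is affine, which gives
  irreducibility, and for independent matrices the parameters can be read off.\<close>

lemma mult_matrix_family:
  assumes "j < n"
  shows "mult_matrix d b' (family t) j x =
    (if j \<in> J then mult_matrix d b K j x else \<Sum>i\<in>J. t (j, i) * mult_matrix d b K i x)"
proof -
  obtain i k where x: "x = (i, k)" by (cases x)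
  have co: "co (mscale (var j) (b' k)) i = mult_matrix d b K j (i, k)" if "j < n" "i < d" "k < d" for j
  proof -
    have "co (mscale (var j) (b' k)) = co (mscale (var j) (b k))"
      using that K_mscale[OF _ b'_diff, of "var j" k]
      by (intro co_cong free_mod_mscale) (auto simp: b'_in basis_in)
    then show ?thesis using that by (simp add: mult_matrix_def)
  qed
  show ?thesis
  proof (cases "i < d \<and> k < d")
    case True
    then have "mult_matrix d b' (family t) j x = co (mscale (lin_subst t j) (b' k)) i"
      using assms by (simp add: x mult_matrix_def coords_family free_mod_mscale b'_in sub_b')
    also have "\<dots> = (if j \<in> J then co (mscale (var j) (b' k)) i
        else \<Sum>l\<in>J. t (j, l) * co (mscale (var l) (b' k)) i)"
      using True J by (simp add: lin_subst_def co_linear_form b'_in)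
    also have "(\<Sum>l\<in>J. t (j, l) * co (mscale (var l) (b' k)) i) = (\<Sum>l\<in>J. t (j, l) * mult_matrix d b K l x)"
      using J True by (intro sum.cong) (auto simp: co x)
    finally show ?thesis using co[OF assms] True by (simp add: x)
  next
    case False
    then have "mult_matrix d b' (family t) j x = 0" "mult_matrix d b K i x = 0" for i
      by (auto simp: mult_matrix_def x)
    then show ?thesis by simp
  qed
qed

text \<open>Along an affine line in parameter space the generators of the chart ring are constant or
  affine in \<open>s\<close>. Restriction to lines keeps the argument to univariate
  polynomials.\<close>

lemma chart_ring_on_line:
  assumes "g \<in> chart_ring n r d b'"
  shows "\<exists>p. \<forall>s. g (family (\<lambda>x. u x + s * (v x - u x))) = poly p s"
proof -
  let ?L = "\<lambda>s. family (\<lambda>x. u x + s * (v x - u x))"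
  obtain h where h: "h \<in> gen_ring (chart_gens n r d b')" "\<forall>K \<in> chart n r d b'. g K = h K"
    using chart_ring_gens[OF assms] by blast
  have "\<exists>p. \<forall>s. h (?L s) = poly p s"
    using h(1)
  proof induction
    case (const a)
    show ?case by (rule exI[of _ "[:a:]"]) simp
  next
    case (gen w)
    then consider
      (coord) k i where "k < r" "w = (\<lambda>K. quot_coords d b' K (free_gen k) i)"
    | (matrix) j x where "j < n" "w = (\<lambda>K. mult_matrix d b' K j x)"
      by (auto simp: chart_gens_def)
    then show ?case
    proof cases
      case coord
      then show ?thesis
        by (intro exI[of _ "[:co (free_gen k) i:]"]) (simp add: coords_family free_gen_in_free_mod)
    next
      case matrix
      show ?thesis
      proof (cases "j \<in> J")
        case True
        then show ?thesis
          using matrix by (intro exI[of _ "[:mult_matrix d b K j x:]"]) (simp add: mult_matrix_family)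
      next
        case False
        then show ?thesis
          using matrix
          by (intro exI[of _ "[:\<Sum>i\<in>J. u (j, i) * mult_matrix d b K i x,
               \<Sum>i\<in>J. (v (j, i) - u (j, i)) * mult_matrix d b K i x:]"])
             (simp add: mult_matrix_family sum_distrib_left sum.distrib distrib_right mult.assoc)
      qed
    qed
  next
    case (add g h)
    then obtain p q where "\<forall>s. g (?L s) = poly p s" "\<forall>s. h (?L s) = poly q s" by blast
    then show ?case by (intro exI[of _ "p + q"]) simp
  next
    case (mult g h)
    then obtain p q where "\<forall>s. g (?L s) = poly p s" "\<forall>s. h (?L s) = poly q s" by blast
    then show ?case by (intro exI[of _ "p * q"]) simp
  qed
  then show ?thesis using h(2) family_in_chart by simp
qed

text \<open>Join a parameter whose point avoids \<open>A\<close> to one whose point avoids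
  \<open>B\<close>. On this line a product of two nonzero univariate polynomials would vanish
  everywhere, impossible over an infinite field.\<close>

lemma irreducible_family:
  assumes ne: "L \<noteq> {}"
    and line: "\<And>u v s. u \<in> L \<Longrightarrow> v \<in> L \<Longrightarrow> (\<lambda>x. u x + s * (v x - u x)) \<in> L"
  shows "irreducible_in (Quot n r d) (family ` L)"
  unfolding irreducible_in_def
proof (intro conjI allI impI)
  show "family ` L \<subseteq> topspace (Quot n r d)"
    using family_in_chart by (auto simp: topspace_Quot chart_def)
  show "family ` L \<noteq> {}" using ne by simp
  fix A B assume AB: "closedin (Quot n r d) A \<and> closedin (Quot n r d) B \<and> family ` L \<subseteq> A \<union> B"
  show "family ` L \<subseteq> A \<or> family ` L \<subseteq> B"
  proof (rule ccontr)
    assume "\<not> ?thesis"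
    then obtain u v where uv: "u \<in> L" "family u \<notin> A" "v \<in> L" "family v \<notin> B" by auto
    obtain g where g: "g \<in> chart_ring n r d b'" "g (family u) \<noteq> 0" "\<forall>K \<in> chart n r d b' \<inter> A. g K = 0"
      using Quot_closed_separate[of n r d A "family u" b'] AB uv family_in_chart by auto
    obtain h where h: "h \<in> chart_ring n r d b'" "h (family v) \<noteq> 0" "\<forall>K \<in> chart n r d b' \<inter> B. h K = 0"
      using Quot_closed_separate[of n r d B "family v" b'] AB uv family_in_chart by auto
    let ?L = "\<lambda>s. family (\<lambda>x. u x + s * (v x - u x))"
    obtain p where p: "\<And>s. g (?L s) = poly p s"
      using chart_ring_on_line[OF g(1)] by blast
    obtain q where q: "\<And>s. h (?L s) = poly q s"
      using chart_ring_on_line[OF h(1)] by blast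
    have "poly (p * q) s = 0" for s
    proof -
      have "?L s \<in> A \<union> B" using AB line[OF uv(1,3)] by blast
      then have "g (?L s) = 0 \<or> h (?L s) = 0" using g(3) h(3) family_in_chart by blast
      then show ?thesis by (auto simp: p q)
    qed
    then have "p * q = 0" using poly_all_0_iff_0 by blast
    moreover have "poly p 0 \<noteq> 0" using g(2) p[of 0] by simp
    moreover have "poly q 1 \<noteq> 0" using h(2) q[of 1] by simp
    ultimately show False by auto
  qed
qed

end

lemma irreducible_in_closure:
  assumes irr: "irreducible_in T S"
  shows "irreducible_in T (T closure_of S)"
proof -
  have top: "S \<subseteq> topspace T" and ne: "S \<noteq> {}"
    using irr by (simp_all add: irreducible_in_def)
  then have S: "S \<subseteq> T closure_of S"
    by (intro closure_of_subset)
  show ?thesis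
    unfolding irreducible_in_def
  proof (intro conjI allI impI)
    show "T closure_of S \<noteq> {}" using S ne by auto
    fix A B assume *: "closedin T A \<and> closedin T B \<and> T closure_of S \<subseteq> A \<union> B"
    then have "S \<subseteq> A \<or> S \<subseteq> B"
      using irr S unfolding irreducible_in_def by (meson order_trans)
    then show "T closure_of S \<subseteq> A \<or> T closure_of S \<subseteq> B"
      using closure_of_minimal[of S A T] closure_of_minimal[of S B T] * by blast
  qed (rule closure_of_subset_topspace)
qed

text \<open>The coefficient of \<open>A j0\<close> in an extended basis is a linear functional.
  Finite support of the \<open>A j\<close> allows it to be written through its values on the unit
  functions, as an explicit combination of matrix entries.\<close>

lemma independent_dual_functional:
  fixes A :: "nat \<Rightarrow> nat \<times> nat \<Rightarrow> 'k::field"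
  assumes inj: "inj_on A J" and ind: "fun_space.independent (A ` J)" and j0: "j0 \<in> J"
    and fin: "finite X" and supp: "\<And>j x. j \<in> J \<Longrightarrow> x \<notin> X \<Longrightarrow> A j x = 0"
  shows "\<exists>\<gamma>. \<forall>j\<in>J. (\<Sum>x\<in>X. \<gamma> x * A j x) = (if j = j0 then 1 else 0)"
proof -
  define B where "B = fun_space.extend_basis (A ` J)"
  have B: "fun_space.independent B" "A ` J \<subseteq> B" "fun_space.span B = UNIV"
    using fun_space.independent_extend_basis[OF ind] fun_space.extend_basis_superset[OF ind]
      fun_space.span_extend_basis[OF ind] by (auto simp: B_def)
  define \<delta> :: "nat \<times> nat \<Rightarrow> nat \<times> nat \<Rightarrow> 'k" where "\<delta> x = (\<lambda>y. if y = x then 1 else 0)" for x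
  define G where "G v = fun_space.representation B v (A j0)" for v
  have "(\<Sum>x\<in>X. G (\<delta> x) * A j x) = (if j = j0 then 1 else 0)" if j: "j \<in> J" for j
  proof -
    have "A j = (\<Sum>x\<in>X. fun_scale (A j x) (\<delta> x))"
    proof
      fix y
      have "(\<Sum>x\<in>X. fun_scale (A j x) (\<delta> x)) y = (\<Sum>x\<in>X. if x = y then A j y else 0)"
        unfolding sum_fun_apply by (intro sum.cong) (auto simp: fun_scale_def \<delta>_def)
      then show "A j y = (\<Sum>x\<in>X. fun_scale (A j x) (\<delta> x)) y"
        using fin supp[OF j, of y] by simp
    qed
    then have "G (A j) = fun_space.representation B (\<Sum>x\<in>X. fun_scale (A j x) (\<delta> x)) (A j0)"
      unfolding G_def by (rule arg_cong)
    also have "\<dots> = (\<Sum>x\<in>X. fun_space.representation B (fun_scale (A j x) (\<delta> x)) (A j0))"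
      by (subst fun_space.representation_sum[OF B(1)]) (simp_all only: B(3) UNIV_I)
    also have "\<dots> = (\<Sum>x\<in>X. A j x * G (\<delta> x))"
      unfolding G_def by (subst fun_space.representation_scale[OF B(1)]) (simp_all only: B(3) UNIV_I)
    finally have "G (A j) = (\<Sum>x\<in>X. G (\<delta> x) * A j x)" by (simp add: mult.commute)
    moreover have "G (A j) = (if A j0 = A j then 1 else 0)"
      unfolding G_def using B j by (subst fun_space.representation_basis) auto
    moreover have "A j0 = A j \<longleftrightarrow> j = j0"
      using inj j j0 by (auto dest: inj_onD)
    ultimately show ?thesis by simp
  qed
  then show ?thesis by (intro exI[of _ "\<lambda>x. G (\<delta> x)"] ballI)
qed

lemma (in deformation) krull_dim_ge:
  assumes inj: "inj_on (mult_matrix d b K) J" and ind: "fun_space.independent (mult_matrix d b K ` J)"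
  shows "ereal (real ((n - card J) * card J)) \<le> krull_dim (Quot n r d :: (nat \<Rightarrow> 'k mpoly) set topology)"
proof -
  let ?Q = "Quot n r d :: (nat \<Rightarrow> 'k mpoly) set topology"
  let ?N = "(n - card J) * card J" and ?I = "({..<n} - J) \<times> J"
  have "card ?I = ?N" "finite ?I"
    using J finite_J by (auto simp: card_cartesian_product card_Diff_subset)
  then obtain e where e: "bij_betw e {0..<?N} ?I"
    using ex_bij_betw_nat_finite[of ?I] by auto
  \<comment> \<open>Parameters supported on the first \<open>q\<close> pairs of the enumeration
    \<open>e\<close>; for \<open>q\<close> up to \<open>?N\<close> each step frees one more
    coefficient.\<close>
  define L where "L q = {t :: nat \<times> nat \<Rightarrow> 'k. \<forall>x. x \<notin> e ` {..<q} \<longrightarrow> t x = 0}" for q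
  define C where "C q = ?Q closure_of (family ` L q)" for q
  have irr: "closedin ?Q (C q) \<and> irreducible_in ?Q (C q)" for q
  proof -
    have "(\<lambda>_. 0) \<in> L q" by (simp add: L_def)
    then have "irreducible_in ?Q (family ` L q)"
      by (intro irreducible_family) (auto simp: L_def)
    then show ?thesis
      by (simp add: C_def irreducible_in_closure)
  qed
  have strict: "C q \<subset> C (Suc q)" if q: "q < ?N" for q
  proof -
    obtain i0 j0 where ij: "e q = (i0, j0)" by (cases "e q")
    have "e q \<in> ?I" by (rule bij_betwE[OF e, rule_format]) (use q in simp)
    then have i0: "i0 < n" "i0 \<notin> J" and j0: "j0 \<in> J" by (auto simp: ij)
    have notin: "e q \<notin> e ` {..<q}"
    proof
      assume "e q \<in> e ` {..<q}"
      then obtain x where "x < q" "e q = e x" by auto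
      then show False
        using inj_onD[OF bij_betw_imp_inj_on[OF e], of q x] q by simp
    qed
    let ?X = "{..<d} \<times> {..<d}"
    have fin_X: "finite ?X" by simp
    have supp: "mult_matrix d b K j x = 0" if "x \<notin> ?X" for j x
      using that by (cases x) (auto simp: mult_matrix_def)
    obtain \<gamma> where \<gamma>: "\<And>j. j \<in> J \<Longrightarrow> (\<Sum>x\<in>?X. \<gamma> x * mult_matrix d b K j x) = (if j = j0 then 1 else 0)"
      using independent_dual_functional[OF inj ind j0 fin_X supp] by metis
    \<comment> \<open>The dual functional applied to the matrix of \<open>i0\<close>: a regular
      function that recovers the parameter \<open>t (i0, j0)\<close> on the family.\<close>
    define g where "g K' = (\<Sum>x\<in>?X. \<gamma> x * mult_matrix d b' K' i0 x)" for K'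
    have "(\<lambda>K'. mult_matrix d b' K' i0 x) \<in> chart_ring n r d b'" if "x \<in> ?X" for x
      using that i0 by (auto simp: mult_matrix_def intro!: chart_ring.coord free_mod_mscale b'_in)
    then have g_ring: "g \<in> chart_ring n r d b'"
      unfolding g_def[abs_def] by (intro chart_ring_sum chart_ring.mult chart_ring.const)
    have g: "g (family t) = t (i0, j0)" for t
    proof -
      have "g (family t) = (\<Sum>x\<in>?X. \<Sum>j\<in>J. t (i0, j) * (\<gamma> x * mult_matrix d b K j x))"
        using i0 by (simp add: g_def mult_matrix_family sum_distrib_left mult_ac)
      also have "\<dots> = (\<Sum>j\<in>J. t (i0, j) * (\<Sum>x\<in>?X. \<gamma> x * mult_matrix d b K j x))"
        by (subst sum.swap) (simp add: sum_distrib_left)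
      also have "\<dots> = (\<Sum>j\<in>J. if j = j0 then t (i0, j) else 0)"
        by (intro sum.cong) (auto simp: \<gamma>)
      finally show ?thesis using j0 finite_J by simp
    qed
    \<comment> \<open>The unit parameter at the newly freed pair. Since \<open>g\<close> is 1 there
      and 0 on the image of \<open>L q\<close>, the open locus where \<open>g\<close> is nonzero
      separates \<open>family u\<close> from the closure.\<close>
    define u :: "nat \<times> nat \<Rightarrow> 'k" where "u x = (if x = e q then 1 else 0)" for x
    have u: "u \<in> L (Suc q)" by (auto simp: u_def L_def)
    have "e ` {..<q} \<subseteq> e ` {..<Suc q}" by (intro image_mono) auto
    then have "L q \<subseteq> L (Suc q)" unfolding L_def by (intro Collect_mono) (metis subsetD)
    then have "C q \<subseteq> C (Suc q)" unfolding C_def by (intro closure_of_mono image_mono)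
    moreover have "family u \<in> C (Suc q)"
    proof -
      have "family ` L (Suc q) \<subseteq> topspace ?Q"
        using family_in_chart by (auto simp: topspace_Quot chart_def)
      then show ?thesis
        unfolding C_def using u closure_of_subset by blast
    qed
    moreover have "family u \<notin> C q"
    proof
      assume "family u \<in> C q"
      moreover have "openin ?Q {K \<in> chart n r d b'. g K \<noteq> 0}"
        using g_ring by (rule openin_chart_nonzero)
      moreover have "family u \<in> {K \<in> chart n r d b'. g K \<noteq> 0}"
        using family_in_chart by (simp add: g u_def ij)
      ultimately have "\<exists>K'. K' \<in> family ` L q \<and> K' \<in> {K \<in> chart n r d b'. g K \<noteq> 0}"
        unfolding C_def in_closure_of by presburger
      then obtain t where "t \<in> L q" "g (family t) \<noteq> 0" by auto
      then show False
        using notin by (simp add: g L_def ij)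
    qed
    ultimately show ?thesis by blast
  qed
  show ?thesis
    unfolding krull_dim_def
    by (intro Sup_upper CollectI exI[of _ ?N] exI[of _ C] conjI allI impI irr strict refl)
qed

text \<open>A basis of the span is taken among the multiplication matrices themselves, so it
  corresponds to a set \<open>J\<close> of \<open>l\<close> variables, as the deformation
  requires.\<close>

lemma krull_dim_Quot_ge:
  fixes K :: "(nat \<Rightarrow> 'k::field_char_0 mpoly) set"
  assumes K: "quot_point n r d b K" and l: "mult_rank n d b K = l"
  shows "ereal (real ((n - l) * l)) \<le> krull_dim (Quot n r d :: (nat \<Rightarrow> 'k mpoly) set topology)"
proof -
  let ?A = "mult_matrix d b K"
  obtain B where B: "B \<subseteq> ?A ` {..<n}" "fun_space.independent B" "?A ` {..<n} \<subseteq> fun_space.span B"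
    "card B = fun_space.dim (?A ` {..<n})"
    using fun_space.basis_exists by blast
  obtain J where JJ: "J \<subseteq> {..<n}" "inj_on ?A J" "B = ?A ` J"
    using B(1) by (auto simp: subset_image_inj)
  have finJ: "finite J" using JJ(1) finite_subset by blast
  have "\<exists>p. \<forall>x. ?A i x = (\<Sum>j\<in>J. p j * ?A j x)" if "i < n" for i
  proof -
    have "?A i \<in> fun_space.span B" using B(3) that by auto
    then obtain u where "?A i = (\<Sum>v\<in>B. fun_scale (u v) v)"
      using fun_space.span_finite[of B] JJ finJ by auto
    then have "?A i x = (\<Sum>j\<in>J. u (?A j) * ?A j x)" for x
      by (simp add: JJ(3) sum.reindex[OF JJ(2)] sum_fun_apply fun_scale_def)
    then show ?thesis by (intro exI[of _ "\<lambda>j. u (?A j)"]) blast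
  qed
  then obtain p where "\<And>i x. i < n \<Longrightarrow> ?A i x = (\<Sum>j\<in>J. p i j * ?A j x)"
    by metis
  then have "deformation n r d b K J (\<lambda>(i, j). p i j)"
    using K JJ(1) by (auto simp: deformation_def deformation_axioms_def)
  then interpret deformation n r d b K J "\<lambda>(i, j). p i j" .
  have "card J = l"
    using l B(4) JJ(2,3) by (simp add: mult_rank_eq_dim card_image)
  then show ?thesis
    using krull_dim_ge B(2) JJ(2,3) by simp
qed

section \<open>Codimension of the complement of the generic stratum\<close>

lemma mult_rank_le: "mult_rank n d b K \<le> d ^ 2"
proof -
  let ?X = "{..<d} \<times> {..<d}"
  define \<delta> :: "nat \<times> nat \<Rightarrow> nat \<times> nat \<Rightarrow> 'a" where "\<delta> x = (\<lambda>y. if y = x then 1 else 0)" for x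
  have "mult_matrix d b K j \<in> fun_space.span (\<delta> ` ?X)" for j
  proof -
    have "mult_matrix d b K j = (\<Sum>x\<in>?X. fun_scale (mult_matrix d b K j x) (\<delta> x))"
    proof
      fix y
      have "(\<Sum>x\<in>?X. fun_scale (mult_matrix d b K j x) (\<delta> x)) y = (\<Sum>x\<in>?X. if x = y then mult_matrix d b K j y else 0)"
        unfolding sum_fun_apply by (intro sum.cong) (auto simp: fun_scale_def \<delta>_def)
      also have "\<dots> = (if y \<in> ?X then mult_matrix d b K j y else 0)"
        by (rule sum.delta) simp
      also have "\<dots> = mult_matrix d b K j y"
        by (cases y) (simp add: mult_matrix_def)
      finally show "mult_matrix d b K j y = (\<Sum>x\<in>?X. fun_scale (mult_matrix d b K j x) (\<delta> x)) y" ..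
    qed
    also have "\<dots> \<in> fun_space.span (\<delta> ` ?X)"
      by (rule fun_space.span_sum, rule fun_space.span_scale, rule fun_space.span_base, rule imageI)
    finally show ?thesis .
  qed
  then have "mult_matrix d b K ` {..<n} \<subseteq> fun_space.span (\<delta> ` ?X)"
    by (rule image_subsetI)
  then have "fun_space.dim (mult_matrix d b K ` {..<n}) \<le> card (\<delta> ` ?X)"
    by (rule fun_space.dim_le_card) simp
  also have "card (\<delta> ` ?X) \<le> card ?X"
    by (rule card_image_le) simp
  also have "card ?X = d ^ 2"
    by (simp add: card_cartesian_product power2_eq_square)
  finally show ?thesis by (simp add: mult_rank_eq_dim)
qed

interpretation id_hom: coeff_hom "\<lambda>x :: 'k::comm_ring_1. x"
  by unfold_locales auto

text \<open>The quotient is the algebra of functions on the points \<open>(i + 1, 0, \<dots>, 0)\<close> with \<open>i < d\<close>, with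
  the basis of Lagrange polynomials; the shift by one makes \<open>x\<^sub>0\<close> act nontrivially also for \<open>d = 1\<close>.\<close>

lemma exists_quot_point_rank_pos:
  assumes n: "n \<ge> 1" and r: "r \<ge> 1" and d: "d \<ge> 1"
  obtains b and K :: "(nat \<Rightarrow> 'k::field_char_0 mpoly) set" where "quot_point n r d b K" "mult_rank n d b K \<ge> 1"
proof -
  define ev :: "nat \<Rightarrow> 'k mpoly \<Rightarrow> 'k" where
    "ev i = mpoly_eval (\<lambda>x. x) (\<lambda>j. if j = 0 then of_nat (Suc i) else 0)" for i
  define lag :: "nat \<Rightarrow> 'k mpoly" where
    "lag i = (\<Prod>j\<in>{..<d} - {i}. const (1 / (of_nat (Suc i) - of_nat (Suc j))) * (var 0 - const (of_nat (Suc j))))" for i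
  define b :: "nat \<Rightarrow> nat \<Rightarrow> 'k mpoly" where "b i = (\<lambda>k. if k = 0 then lag i else 0)" for i
  define K where "K = {f \<in> free_mod n r. \<forall>i<d. ev i (f 0) = 0}"
  have ev_lag: "ev k (lag i) = (if i = k then 1 else 0)" if "k < d" for i k
  proof -
    have "ev k (lag i) = (\<Prod>j\<in>{..<d} - {i}. (of_nat (Suc k) - of_nat (Suc j)) / (of_nat (Suc i) - of_nat (Suc j)))"
      by (simp add: ev_def lag_def id_hom.eval_prod)
    also have "\<dots> = (if i = k then 1 else 0)"
    proof (cases "i = k")
      case True
      then show ?thesis by (simp add: prod.neutral)
    next
      case False
      then have "k \<in> {..<d} - {i}" using that by simp
      then have "(\<Prod>j\<in>{..<d} - {i}. (of_nat (Suc k) - of_nat (Suc j)) / (of_nat (Suc i) - of_nat (Suc j))) = (0 :: 'k)"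
        by (intro prod_zero) (auto intro: bexI[of _ k])
      then show ?thesis using False by simp
    qed
    finally show ?thesis .
  qed
  have lag: "lag i \<in> polys n" for i
    unfolding lag_def using n
    by (intro polys_prod polys_mult polys_diff const_in_polys var_in_polys) simp
  then have b: "b i \<in> free_mod n r" for i
    using r by (auto simp: free_mod_def b_def)
  have ev_lincomb: "ev k (lincomb d c b 0) = c k" if "k < d" for c k
  proof -
    have "ev k (lincomb d c b 0) = (\<Sum>i<d. c i * (if i = k then 1 else 0))"
      using ev_lag[OF that]
      by (simp add: lincomb_def sum_fun_apply mscale_def b_def ev_def id_hom.eval_sum)
    then show ?thesis using that by (simp add: if_distrib cong: if_cong)
  qed
  have iff: "f - lincomb d c b \<in> K \<longleftrightarrow> (\<forall>i<d. c i = ev i (f 0))" if f: "f \<in> free_mod n r" for f c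
  proof -
    have "ev k ((f - lincomb d c b) 0) = ev k (f 0) - c k" if "k < d" for k
      using ev_lincomb[OF that, of c] by (simp add: ev_def)
    then show ?thesis
      using f b by (auto simp: K_def free_mod_diff lincomb_in_free_mod)
  qed
  have qp: "quot_point n r d b K"
  proof
    show "is_submod n r K"
      unfolding is_submod_def
    proof (intro conjI ballI)
      fix p :: "'k mpoly" and f assume "p \<in> polys n" "f \<in> K"
      then show "mscale p f \<in> K"
        using free_mod_mscale[of p n f r] by (simp add: K_def ev_def mscale_def)
    qed (auto simp: K_def ev_def free_mod_add)
    show "quot_basis n r d b K"
      unfolding quot_basis_def lincomb_def[symmetric]
    proof (intro conjI allI impI ballI b)
      fix f :: "nat \<Rightarrow> 'k mpoly" assume f: "f \<in> free_mod n r"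
      show "\<exists>!c. (\<forall>i\<ge>d. c i = 0) \<and> f - lincomb d c b \<in> K"
        unfolding iff[OF f]
      proof (rule ex1I)
        show "(\<forall>i\<ge>d. (\<lambda>i. if i < d then ev i (f 0) else 0) i = 0) \<and>
            (\<forall>i<d. (\<lambda>i. if i < d then ev i (f 0) else 0) i = ev i (f 0))"
          by simp
        fix c assume "(\<forall>i\<ge>d. c i = 0) \<and> (\<forall>i<d. c i = ev i (f 0))"
        then show "c = (\<lambda>i. if i < d then ev i (f 0) else 0)"
          by (auto simp: fun_eq_iff)
      qed
    qed
  qed
  interpret quot_point n r d b K by (rule qp)
  have f: "mscale (var 0) (b 0) \<in> free_mod n r"
    using n b by (intro free_mod_mscale) auto
  \<comment> \<open>This entry is the value of \<open>var 0 * lag 0\<close> at the first point,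
    whose leading coordinate is 1 by the shift.\<close>
  have "mult_matrix d b K 0 (0, 0) = ev 0 (mscale (var 0) (b 0) 0)"
    using co_rem[OF f] iff[OF f] d by (simp add: mult_matrix_def)
  also have "\<dots> = 1"
    using ev_lag[of 0 0] d by (simp add: mscale_def b_def ev_def)
  finally have "mult_matrix d b K 0 (0, 0) = 1" .
  \<comment> \<open>In rank 0 the factorization is an empty sum and would make every matrix entry
    vanish.\<close>
  moreover have "mult_matrix d b K 0 (0, 0) = 0" if "mult_rank n d b K \<le> 0"
    using mult_matrix_factorization[OF that] n by auto
  ultimately show ?thesis by (intro that[OF qp]) fastforce
qed

lemma mem_stratum_iff:
  "K \<in> stratum n r d l \<longleftrightarrow> (\<exists>b. quot_point n r d b K \<and> mult_rank n d b K = l)"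
  unfolding stratum_def mult_rank_def quot_points_def quot_point_def by auto

text \<open>By \<open>mult_rank_le\<close> the cap at \<open>d ^ 2\<close> inside
  \<open>l_max\<close> discards no nonempty stratum, so the maximum bounds the rank for every point
  and basis. The example of positive rank makes \<open>l - 1\<close> a true predecessor.\<close>

lemma l_max_properties:
  assumes "n \<ge> 1" "r \<ge> 1" "d \<ge> 1"
  defines "l \<equiv> l_max TYPE('k::field_char_0) n r d"
  shows "1 \<le> l" "l \<le> d ^ 2" "\<exists>b (K :: (nat \<Rightarrow> 'k mpoly) set). quot_point n r d b K \<and> mult_rank n d b K = l"
    "\<And>b (K :: (nat \<Rightarrow> 'k mpoly) set). quot_point n r d b K \<Longrightarrow> mult_rank n d b K \<le> l"
proof -
  let ?S = "{l. l \<le> d ^ 2 \<and> (stratum n r d l :: (nat \<Rightarrow> 'k mpoly) set set) \<noteq> {}}"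
  have fin: "finite ?S" by simp
  have mem: "mult_rank n d b K \<in> ?S" if "quot_point n r d b K" for b and K :: "(nat \<Rightarrow> 'k mpoly) set"
    using that mult_rank_le[of n d b K] mem_stratum_iff[of K n r d "mult_rank n d b K"] by auto
  then show upper: "mult_rank n d b K \<le> l" if "quot_point n r d b K" for b and K :: "(nat \<Rightarrow> 'k mpoly) set"
    unfolding l_def l_max_def using that by (intro Max_ge fin)
  obtain b and K :: "(nat \<Rightarrow> 'k mpoly) set" where K: "quot_point n r d b K" "mult_rank n d b K \<ge> 1"
    using exists_quot_point_rank_pos[OF assms(1-3)] .
  show "1 \<le> l" using upper[OF K(1)] K(2) by linarith
  have "?S \<noteq> {}" using mem[OF K(1)] by blast
  then have "l \<in> ?S" unfolding l_def l_max_def by (rule Max_in[OF fin])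
  then show "l \<le> d ^ 2" by simp
  from \<open>l \<in> ?S\<close> obtain K :: "(nat \<Rightarrow> 'k mpoly) set" where "K \<in> stratum n r d l" by auto
  then show "\<exists>b (K :: (nat \<Rightarrow> 'k mpoly) set). quot_point n r d b K \<and> mult_rank n d b K = l"
    unfolding mem_stratum_iff by blast
qed

text \<open>The leading terms leave \<open>n - l * l\<close>; the losses \<open>l * l\<close> and
  \<open>(l - 1) * d ^ 2\<close> are each at most \<open>d ^ 4\<close>, and \<open>r * d\<close>
  comes from the generators.\<close>

lemma codim_stratum_ge:
  fixes n d r :: nat
  assumes n: "n \<ge> 1" "n \<ge> d ^ 2" and r: "r \<ge> 1" and d: "d \<ge> 1"
  shows "real n - real (2 * d ^ 4 + r * d) \<le>
    codim (Quot n r d :: (nat \<Rightarrow> 'k::field_char_0 mpoly) set topology)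
      (quot_points n r d - stratum n r d (l_max TYPE('k) n r d))"
proof -
  let ?Q = "Quot n r d :: (nat \<Rightarrow> 'k mpoly) set topology"
  define l where "l = l_max TYPE('k) n r d"
  define Y :: "(nat \<Rightarrow> 'k mpoly) set set" where "Y = quot_points n r d - stratum n r d l"
  note l = l_max_properties[OF n(1) r d, where 'k = 'k, folded l_def]
  \<comment> \<open>This crude bound serves only to make the dimension finite, so that the lower
    bound survives the conversion to real numbers.\<close>
  have "krull_dim (subtopology ?Q (quot_points n r d)) \<le> ereal (real (n * d ^ 2 + d ^ 2 * d ^ 2 + r * d))"
    by (rule krull_dim_le[OF mult_rank_le])
  then have upper: "krull_dim ?Q \<le> ereal (real (n * d ^ 2 + d ^ 2 * d ^ 2 + r * d))"
    by (simp only: topspace_Quot[symmetric] subtopology_topspace)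
  have lower: "ereal (real ((n - l) * l)) \<le> krull_dim ?Q"
    using l(3) krull_dim_Quot_ge by blast
  have dim: "real ((n - l) * l) \<le> real_of_ereal (krull_dim ?Q)"
    using upper lower by (cases "krull_dim ?Q") auto
  \<comment> \<open>Membership in the stratum asks for some basis of rank \<open>l\<close>, so
    outside it every basis has rank different from \<open>l\<close>, hence below the
    maximum.\<close>
  have "mult_rank n d b K \<le> l - 1" if "K \<in> Y" "K \<in> chart n r d b" for K b
  proof -
    have qp: "quot_point n r d b K" using that(2) by (rule chart_quot_point)
    then have "K \<in> stratum n r d (mult_rank n d b K)"
      unfolding mem_stratum_iff by blast
    then have "mult_rank n d b K \<noteq> l"
      using that(1) by (auto simp: Y_def)
    then show ?thesis using l(4)[OF qp] by simp
  qed
  then have "krull_dim (subtopology ?Q Y) \<le> ereal (real (n * (l - 1) + (l - 1) * d ^ 2 + r * d))"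
    by (rule krull_dim_le)
  \<comment> \<open>If \<open>Y\<close> is empty, its dimension minus infinity is read as 0, which
    still lies below the nonnegative bound.\<close>
  then have dim_Y: "real_of_ereal (krull_dim (subtopology ?Q Y)) \<le> real (n * (l - 1) + (l - 1) * d ^ 2 + r * d)"
    by (cases "krull_dim (subtopology ?Q Y)") auto
  have "l \<le> n" using l(2) n(2) by linarith
  \<comment> \<open>Rewriting \<open>n\<close> and \<open>l\<close> this way removes the truncated
    subtractions before passing to the reals.\<close>
  then obtain k m where "n = l + k" "l = Suc m"
    using l(1) by (metis One_nat_def Suc_le_D le_Suc_ex)
  then have "real ((n - l) * l) - real (n * (l - 1) + (l - 1) * d ^ 2 + r * d) =
      real n - (real (l * l) + real ((l - 1) * d ^ 2) + real (r * d))"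
    by (simp add: algebra_simps)
  moreover have "l * l \<le> d ^ 4" "(l - 1) * d ^ 2 \<le> d ^ 4"
    using mult_le_mono[OF l(2) l(2)] mult_le_mono1[of "l - 1" "d ^ 2" "d ^ 2"] l(2)
    by (simp_all flip: power_add)
  then have "real (l * l) \<le> real (d ^ 4)" "real ((l - 1) * d ^ 2) \<le> real (d ^ 4)"
    by (simp_all only: of_nat_le_iff)
  ultimately show ?thesis
    using dim dim_Y unfolding codim_def l_def[symmetric] Y_def[symmetric] by simp
qed

theorem mainTheorem8:
  fixes d r :: nat
  assumes "d \<ge> 1" and "r \<ge> 1"
  shows "filterlim
    (\<lambda>n. codim (Quot n r d :: (nat \<Rightarrow> 'k::{alg_closed_field, field_char_0} mpoly) set topology)
           (quot_points n r d - stratum n r d (l_max TYPE('k) n r d)))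
    at_top sequentially"
proof (rule filterlim_at_top_mono)
  have "filterlim (\<lambda>n. - real (2 * d ^ 4 + r * d) + real n) at_top sequentially"
    by (rule filterlim_tendsto_add_at_top[OF tendsto_const filterlim_real_sequentially])
  then show "filterlim (\<lambda>n. real n - real (2 * d ^ 4 + r * d)) at_top sequentially"
    by (simp only: add.commute[of "- _"] add_uminus_conv_diff)
  show "eventually (\<lambda>n. real n - real (2 * d ^ 4 + r * d) \<le>
      codim (Quot n r d :: (nat \<Rightarrow> 'k mpoly) set topology)
        (quot_points n r d - stratum n r d (l_max TYPE('k) n r d))) sequentially"
    using eventually_ge_at_top[of 1] eventually_ge_at_top[of "d ^ 2"]
    by eventually_elim (rule codim_stratum_ge, use assms in auto)
qed

end
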